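(* Let $B$ be the triangular model (in $H=\mathbf L^2(\Delta;\mathbb C^p)$, $\Delta=[-l,l]$) of a coupling of a dissipative and an antidissipative operator with absolutely continuous real spectra, as described in the context. Suppose $B^*=-UBU^*$ for some unitary operator $U:H\to H$, and let $A=bB^3$ ($b\in\mathbb R$) and $B$ be embedded in the commutative regular colligation $X=(A=bB^3,B;H,\widetilde\Phi,E=\mathbb C^{3m};\sigma_A,\sigma_B,\gamma,\widetilde\gamma)$ of the context. Let $T(x,t)=e^{i(tA+xB)}$, let $M$ be the operator built from $\rho$ in the context, let $\Gamma(x,t)=T(x,t)+U^*(T(x,t)^{*})^{-1}M$, and let $S(x,t)=\Gamma^{-1}(x,t)\Gamma_x(x,t)$ at the real points $(x,t)$ where $\Gamma(x,t)$ is invertible. For $g\in G_B=(B-B^* )H$ put $h(x,t)=S(x,t)g-iBg$. Then, with $v_f(\xi)=\widetilde\Phi e^{i\xi B}f$ for $f\in H$, the mode $v_{h}(\xi)=v_{h(x,t)}(\xi)=\widetilde\Phi e^{i\xi B}h(x,t)$ satisfies the integral equation $$v_{h(x,t)}(\xi)=-\int_0^{\infty}\Psi(-2x+\xi+\eta,-2t)\,v_{h}(\eta)\,d\eta+\Psi(-2x+\xi,-2t)\,v_g(0),$$ where $\Psi(x,t)=\widetilde\Phi\,T(x,t)\,\widetilde\rho\,\widetilde\Phi^*\sigma_B$ and $\widetilde\rho=U^*\rho$.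
   Context: Conventions. Elements of $\mathbb C^k$ are row vectors and a matrix $K$ defines the operator $h\mapsto hK$; products of operators are compositions. $\mathbb C^{3m}=(\mathbb C^m)^3$. Triangular model. $1\le p\le m$, $\Delta=[-l,l]$, $H=\mathbf L^2(\Delta;\mathbb C^p)$. $L$ is an invertible Hermitian $m\times m$ matrix with $L=J_1-J_2+S_0+S_0^*$, where $J_1=\begin{pmatrix}I_r&0\\0&0\end{pmatrix}$, $J_2=\begin{pmatrix}0&0\\0&I_{m-r}\end{pmatrix}$, $S_0=\begin{pmatrix}0&0\\ \widehat S&0\end{pmatrix}$ and $r$, $m-r$ are the numbers of positive and negative eigenvalues of $L$. $\Pi(w)$ is a measurable $p\times m$ matrix function on $\Delta$ whose rows are linearly independent at each point of a set of positive measure, and $\widetilde\Pi(w)=\Pi^*(w)\Pi(w)$ satisfies $\operatorname{tr}\widetilde\Pi(w)=1$, $\widetilde\Pi(w)J_1=J_1\widetilde\Pi(w)$ and a Hölder condition $\|\widetilde\Pi(w_1)-\widetilde\Pi(w_2)\|\le C|w_1-w_2|^{\alpha_1}$, $0<\alpha_1\le1$. The operator $B$ is $$Bf(w)=wf(w)-i\int_{-l}^{w}f(\xi)\Pi(\xi)S_0^*\Pi^*(w)d\xi+i\int_w^{l}f(\xi)\Pi(\xi)S_0\Pi^*(w)d\xi+i\int_{-l}^{w}f(\xi)\Pi(\xi)L\Pi^*(w)d\xi .$$ Let $\Phi:H\to\mathbb C^m$, $\Phi f=\int_{\Delta}f(w)\Pi(w)dw$; then $(B-B^* )/i=\Phi^*L\Phi$.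 It is known that $\text{s-}\lim_{x\to+\infty}e^{-ixB^*}e^{ixB}$ exists. Operator $M$. $\rho$ is a bounded linear operator on $H$ commuting with multiplication by the independent variable, and $M=\int_0^\infty e^{-i\eta B^*}\rho\,\frac{B-B^*}{i}\,e^{i\eta B}d\eta$ (strong limit; it is known that it exists and that $B^*M-MB=\rho(B^*-B)$). Integrals over $(0,\infty)$ in the claim are understood in the corresponding sense. Colligation. $\widetilde\Phi f=(\Phi f,\Phi B^*f,\Phi B^{*2}f)\in\mathbb C^{3m}$, $$\sigma_A=\begin{pmatrix}0&0&bL\\ 0&bL&0\\ bL&0&0\end{pmatrix},\quad \sigma_B=\begin{pmatrix}L&0&0\\0&0&0\\0&0&0\end{pmatrix},\quad \gamma=\begin{pmatrix}0&0&0\\0&0&bL\\0&bL&0\end{pmatrix},$$ $\widetilde\gamma=\gamma+i(\sigma_A\widetilde\Phi\widetilde\Phi^*\sigma_B-\sigma_B\widetilde\Phi\widetilde\Phi^*\sigma_A)$ (as operators). These satisfy $(A-A^* )/i=\widetilde\Phi^*\sigma_A\widetilde\Phi$, $(B-B^* )/i=\widetilde\Phi^*\sigma_B\widetilde\Phi$, $\sigma_A\widetilde\Phi B^*-\sigma_B\widetilde\Phi A^*=\gamma\widetilde\Phi$, $\sigma_A\widetilde\Phi B-\sigma_B\widetilde\Phi A=\widetilde\gamma\widetilde\Phi$. *)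

theory Defs
  imports "HOL-Analysis.Analysis" "HOL-Computational_Algebra.Polynomial"
begin

section \<open>Complex inner product spaces\<close>

class complex_inner = real_inner +
  fixes scaleC :: "complex \<Rightarrow> 'a \<Rightarrow> 'a" (infixr "*\<^sub>C" 75)
    and cinner :: "'a \<Rightarrow> 'a \<Rightarrow> complex"
  assumes scaleC_of_real: "of_real r *\<^sub>C x = r *\<^sub>R x"
    and scaleC_add_right: "c *\<^sub>C (x + y) = c *\<^sub>C x + c *\<^sub>C y"
    and scaleC_add_left: "(c + d) *\<^sub>C x = c *\<^sub>C x + d *\<^sub>C x"
    and scaleC_scaleC: "c *\<^sub>C d *\<^sub>C x = (c * d) *\<^sub>C x"
    and cinner_commute: "cinner x y = cnj (cinner y x)"
    and cinner_add_left: "cinner (x + y) z = cinner x z + cinner y z"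
    and cinner_scaleC_left: "cinner (c *\<^sub>C x) y = c * cinner x y"
    and cinner_self: "cinner x x = of_real ((norm x)\<^sup>2)"

instantiation complex :: complex_inner
begin
definition scaleC_complex_def: "c *\<^sub>C (z::complex) = c * z"
definition cinner_complex_def: "cinner z (w::complex) = z * cnj w"
instance
proof
  fix x :: complex
  show "cinner x x = of_real ((norm x)\<^sup>2)"
    by (simp add: cinner_complex_def complex_norm_square[symmetric] del: of_real_power)
qed (auto simp: scaleC_complex_def cinner_complex_def algebra_simps scaleR_conv_of_real)
end

instantiation vec :: (complex_inner, finite) complex_inner
begin
definition scaleC_vec_def: "c *\<^sub>C x = (\<chi> i. c *\<^sub>C (x $ i))"
definition cinner_vec_def: "cinner x y = (\<Sum>i\<in>UNIV. cinner (x $ i) (y $ i))"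
instance
proof
  fix x :: "'a ^ 'b"
  have "(norm x)\<^sup>2 = (\<Sum>i\<in>UNIV. (norm (x $ i))\<^sup>2)"
    by (simp add: norm_vec_def L2_set_def sum_nonneg)
  then show "cinner x x = of_real ((norm x)\<^sup>2)"
    by (simp add: cinner_vec_def cinner_self)
next
  fix x y :: "'a ^ 'b"
  show "cinner x y = cnj (cinner y x)"
    unfolding cinner_vec_def by (subst cnj_sum) (intro sum.cong refl cinner_commute)
qed (auto simp: scaleC_vec_def cinner_vec_def vec_eq_iff scaleC_of_real scaleC_add_right
      scaleC_add_left scaleC_scaleC cinner_add_left cinner_scaleC_left sum.distrib sum_distrib_left)
end

section \<open>The Hilbert space of square integrable vector functions on the line\<close>

definition square_integrable :: "(real \<Rightarrow> complex ^ 'p::finite) \<Rightarrow> bool" where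
  "square_integrable f \<longleftrightarrow>
     f \<in> borel_measurable lebesgue \<and> integrable lebesgue (\<lambda>w. (norm (f w))\<^sup>2)"

definition l2_rel :: "(real \<Rightarrow> complex ^ 'p::finite) \<Rightarrow> (real \<Rightarrow> complex ^ 'p) \<Rightarrow> bool" where
  "l2_rel f g \<longleftrightarrow> square_integrable f \<and> square_integrable g \<and> (AE w in lebesgue. f w = g w)"

lemma square_integrable_zero: "square_integrable (\<lambda>w. 0)"
  by (simp add: square_integrable_def)

lemma norm_add_sq_le: "(norm (x + y :: 'a::real_normed_vector))\<^sup>2 \<le> 2 * (norm x)\<^sup>2 + 2 * (norm y)\<^sup>2"
proof -
  have "(norm (x + y))\<^sup>2 \<le> (norm x + norm y)\<^sup>2"
    by (intro power_mono norm_triangle_ineq) auto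
  also have "\<dots> \<le> 2 * (norm x)\<^sup>2 + 2 * (norm y)\<^sup>2"
    using sum_squares_ge_zero[of "norm x - norm y" 0] by (simp add: power2_eq_square algebra_simps)
  finally show ?thesis .
qed

lemma square_integrable_add:
  assumes "square_integrable f" "square_integrable g"
  shows "square_integrable (\<lambda>w. f w + g w)"
  unfolding square_integrable_def
proof
  have [measurable]: "f \<in> borel_measurable lebesgue" "g \<in> borel_measurable lebesgue"
    using assms by (auto simp: square_integrable_def)
  show "(\<lambda>w. f w + g w) \<in> borel_measurable lebesgue" by measurable
  show "integrable lebesgue (\<lambda>w. (norm (f w + g w))\<^sup>2)"
    by (rule Bochner_Integration.integrable_bound[of _ "\<lambda>w. 2 * (norm (f w))\<^sup>2 + 2 * (norm (g w))\<^sup>2"])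
       (use assms norm_add_sq_le in \<open>auto simp: square_integrable_def\<close>)
qed

lemma norm_scaleC: "norm (c *\<^sub>C x) = cmod c * norm (x::'a::complex_inner)"
proof -
  have "cinner (c *\<^sub>C x) (c *\<^sub>C x) = c * cnj c * cinner x x"
    by (metis (no_types, lifting) cinner_commute cinner_scaleC_left complex_cnj_mult mult.assoc)
  then have "complex_of_real ((norm (c *\<^sub>C x))\<^sup>2) = of_real ((cmod c * norm x)\<^sup>2)"
    unfolding cinner_self power_mult_distrib of_real_mult complex_norm_square[symmetric]
    by (simp add: complex_norm_square)
  then have "(norm (c *\<^sub>C x))\<^sup>2 = (cmod c * norm x)\<^sup>2" by (simp only: of_real_eq_iff)
  then show ?thesis by (simp add: power2_eq_iff_nonneg)
qed

lemma scaleC_vec_eq: "c *\<^sub>C (x :: complex ^ 'n) = c *s x"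
  by (simp add: scaleC_vec_def scaleC_complex_def vector_scalar_mult_def)

lemma square_integrable_scaleC:
  assumes "square_integrable f"
  shows "square_integrable (\<lambda>w. c *\<^sub>C f w)"
  unfolding square_integrable_def
proof
  have f: "f \<in> borel_measurable lebesgue" using assms by (auto simp: square_integrable_def)
  have "(*\<^sub>C) c \<in> borel_measurable (borel :: (complex ^ 'a) measure)"
    unfolding scaleC_vec_def scaleC_complex_def
    by (intro borel_measurable_continuous_onI continuous_intros)
  from measurable_compose[OF f this] show "(\<lambda>w. c *\<^sub>C f w) \<in> borel_measurable lebesgue" .
  show "integrable lebesgue (\<lambda>w. (norm (c *\<^sub>C f w))\<^sup>2)"
    using assms by (simp add: norm_scaleC power_mult_distrib square_integrable_def)
qed

lemma square_integrable_scaleR: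
  "square_integrable f \<Longrightarrow> square_integrable (\<lambda>w. r *\<^sub>R f w)"
  using square_integrable_scaleC[of f "of_real r"] by (simp add: scaleC_of_real)

lemma square_integrable_uminus: "square_integrable f \<Longrightarrow> square_integrable (\<lambda>w. - f w)"
  using square_integrable_scaleR[of f "-1"] by simp

lemma square_integrable_diff:
  "square_integrable f \<Longrightarrow> square_integrable g \<Longrightarrow> square_integrable (\<lambda>w. f w - g w)"
  using square_integrable_add[of f "\<lambda>w. - g w"] square_integrable_uminus[of g] by simp

lemma norm_cinner_le: "cmod (cinner x (y :: complex ^ 'n)) \<le> (norm x)\<^sup>2 + (norm y)\<^sup>2"
proof -
  have "cmod (cinner x y) \<le> (\<Sum>i\<in>UNIV. cmod (x $ i) * cmod (y $ i))"
    unfolding cinner_vec_def cinner_complex_def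
    by (rule order_trans[OF norm_sum]) (simp add: norm_mult)
  also have "\<dots> \<le> (\<Sum>i\<in>UNIV. (cmod (x $ i))\<^sup>2 + (cmod (y $ i))\<^sup>2)"
  proof (rule sum_mono)
    fix i
    have "2 * (cmod (x $ i) * cmod (y $ i)) \<le> (cmod (x $ i))\<^sup>2 + (cmod (y $ i))\<^sup>2"
      using sum_squares_bound[of "cmod (x $ i)" "cmod (y $ i)"] by (simp add: mult.assoc)
    moreover have "0 \<le> cmod (x $ i) * cmod (y $ i)" by simp
    ultimately show "cmod (x $ i) * cmod (y $ i) \<le> (cmod (x $ i))\<^sup>2 + (cmod (y $ i))\<^sup>2"
      by linarith
  qed
  finally show ?thesis by (simp add: sum.distrib norm_vec_def L2_set_def sum_nonneg)
qed

lemma borel_measurable_cinner: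
  assumes "f \<in> borel_measurable M" "g \<in> borel_measurable M"
  shows "(\<lambda>w. cinner (f w) (g w :: complex ^ 'n)) \<in> borel_measurable M"
proof -
  have "(\<lambda>z. cinner (fst z) (snd z :: complex ^ 'n)) \<in> borel_measurable borel"
    unfolding cinner_vec_def cinner_complex_def
    by (intro borel_measurable_continuous_onI continuous_intros)
  from measurable_compose[OF borel_measurable_Pair[OF assms] this] show ?thesis by simp
qed

lemma integrable_cinner:
  assumes "square_integrable f" "square_integrable g"
  shows "integrable lebesgue (\<lambda>w. cinner (f w) (g w))"
  by (rule Bochner_Integration.integrable_bound[of _ "\<lambda>w. (norm (f w))\<^sup>2 + (norm (g w))\<^sup>2"])
     (use assms norm_cinner_le in \<open>auto simp: square_integrable_def intro!: borel_measurable_cinner\<close>)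

lemma inner_eq_Re_cinner: "inner x (y :: complex ^ 'n) = Re (cinner x y)"
  by (simp add: inner_vec_def cinner_vec_def cinner_complex_def inner_complex_def)

lemma integrable_inner_l2:
  assumes "square_integrable f" "square_integrable g"
  shows "integrable lebesgue (\<lambda>w. inner (f w) (g w))"
  using integrable_cinner[OF assms] unfolding inner_eq_Re_cinner by (rule integrable_Re)

quotient_type 'p l2 = "real \<Rightarrow> complex ^ 'p" / partial: "l2_rel :: (real \<Rightarrow> complex ^ 'p::finite) \<Rightarrow> _"
proof (rule part_equivpI)
  show "\<exists>f::real \<Rightarrow> complex ^ 'p. l2_rel f f"
    by (rule exI[of _ "\<lambda>w. 0"]) (simp add: l2_rel_def square_integrable_zero)
  show "symp (l2_rel :: (real \<Rightarrow> complex ^ 'p) \<Rightarrow> _)"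
    by (auto simp: symp_def l2_rel_def)
  show "transp (l2_rel :: (real \<Rightarrow> complex ^ 'p) \<Rightarrow> _)"
    by (auto simp: transp_def l2_rel_def)
qed

instantiation l2 :: (finite) real_vector
begin

lift_definition zero_l2 :: "'a l2" is "\<lambda>w. 0"
  by (simp add: l2_rel_def square_integrable_zero)

lift_definition plus_l2 :: "'a l2 \<Rightarrow> 'a l2 \<Rightarrow> 'a l2" is "\<lambda>f g w. f w + g w"
  by (auto simp: l2_rel_def square_integrable_add)

lift_definition minus_l2 :: "'a l2 \<Rightarrow> 'a l2 \<Rightarrow> 'a l2" is "\<lambda>f g w. f w - g w"
  by (auto simp: l2_rel_def square_integrable_diff)

lift_definition uminus_l2 :: "'a l2 \<Rightarrow> 'a l2" is "\<lambda>f w. - f w"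
  by (auto simp: l2_rel_def square_integrable_uminus)

lift_definition scaleR_l2 :: "real \<Rightarrow> 'a l2 \<Rightarrow> 'a l2" is "\<lambda>r f w. r *\<^sub>R f w"
  by (auto simp: l2_rel_def square_integrable_scaleR)

instance
proof
  fix f g h :: "'a l2" and r s :: real
  show "f + g + h = f + (g + h)" "f + g = g + f" "0 + f = f" "- f + f = 0" "f - g = f + - g"
    by (transfer; auto simp: l2_rel_def square_integrable_add square_integrable_zero
          square_integrable_uminus square_integrable_diff algebra_simps)+
  show "r *\<^sub>R (f + g) = r *\<^sub>R f + r *\<^sub>R g" "(r + s) *\<^sub>R f = r *\<^sub>R f + s *\<^sub>R f"
    "r *\<^sub>R s *\<^sub>R f = (r * s) *\<^sub>R f" "1 *\<^sub>R f = f"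
    by (transfer; auto simp: l2_rel_def square_integrable_add square_integrable_scaleR algebra_simps
          intro!: square_integrable_scaleR square_integrable_add)+
qed

end

instantiation l2 :: (finite) complex_inner
begin

lift_definition scaleC_l2 :: "complex \<Rightarrow> 'a l2 \<Rightarrow> 'a l2" is "\<lambda>c f w. c *\<^sub>C f w"
  by (auto simp: l2_rel_def square_integrable_scaleC)

lift_definition inner_l2 :: "'a l2 \<Rightarrow> 'a l2 \<Rightarrow> real"
  is "\<lambda>f g. integral\<^sup>L lebesgue (\<lambda>w. inner (f w) (g w))"
  by (auto simp: l2_rel_def square_integrable_def intro!: integral_cong_AE borel_measurable_inner)

lift_definition cinner_l2 :: "'a l2 \<Rightarrow> 'a l2 \<Rightarrow> complex"
  is "\<lambda>f g. integral\<^sup>L lebesgue (\<lambda>w. cinner (f w) (g w))"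
  by (auto simp: l2_rel_def square_integrable_def intro!: integral_cong_AE borel_measurable_cinner)

definition "norm (f::'a l2) = sqrt (inner f f)"
definition "dist (f::'a l2) g = norm (f - g)"
definition "sgn (f::'a l2) = f /\<^sub>R norm f"
definition [code del]:
  "(uniformity :: ('a l2 \<times> 'a l2) filter) = (INF e\<in>{0<..}. principal {(f, g). dist f g < e})"
definition [code del]:
  "open (S :: 'a l2 set) \<longleftrightarrow> (\<forall>f\<in>S. \<forall>\<^sub>F (f', g) in uniformity. f' = f \<longrightarrow> g \<in> S)"

instance
proof
  fix f g h :: "'a l2" and r :: real and c d :: complex
  show "of_real r *\<^sub>C f = r *\<^sub>R f" "c *\<^sub>C (f + g) = c *\<^sub>C f + c *\<^sub>C g"
    "(c + d) *\<^sub>C f = c *\<^sub>C f + d *\<^sub>C f" "c *\<^sub>C d *\<^sub>C f = (c * d) *\<^sub>C f"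
    by (transfer; auto simp: l2_rel_def scaleC_of_real scaleC_add_right scaleC_add_left scaleC_scaleC
          intro!: square_integrable_add square_integrable_scaleC square_integrable_scaleR)+
  show "dist f g = norm (f - g)" by (simp add: dist_l2_def)
  show "sgn f = f /\<^sub>R norm f" by (simp add: sgn_l2_def)
  show "norm f = sqrt (inner f f)" by (simp add: norm_l2_def)
  show "inner f g = inner g f" by transfer (simp add: inner_commute)
  show "inner (f + g) h = inner f h + inner g h"
    by transfer (simp add: l2_rel_def inner_add_left integrable_inner_l2)
  show "inner (r *\<^sub>R f) g = r * inner f g"
    by transfer (simp add: l2_rel_def)
  show "0 \<le> inner f f" by transfer simp
  show "inner f f = 0 \<longleftrightarrow> f = 0"
  proof transfer
    fix f :: "real \<Rightarrow> complex ^ 'a" assume f: "l2_rel f f"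
    have "(integral\<^sup>L lebesgue (\<lambda>w. inner (f w) (f w)) = 0) \<longleftrightarrow> (AE w in lebesgue. inner (f w) (f w) = 0)"
      using f by (intro integral_nonneg_eq_0_iff_AE integrable_inner_l2) (auto simp: l2_rel_def)
    then show "(integral\<^sup>L lebesgue (\<lambda>w. inner (f w) (f w)) = 0) = l2_rel f (\<lambda>w. 0)"
      using f by (simp add: l2_rel_def square_integrable_zero)
  qed
  show "cinner f g = cnj (cinner g f)"
    by transfer (metis (no_types, lifting) Bochner_Integration.integral_cong cinner_commute
        Bochner_Integration.integral_cnj)
  show "cinner (f + g) h = cinner f h + cinner g h"
    by transfer (simp add: l2_rel_def cinner_add_left integrable_cinner)
  show "cinner (c *\<^sub>C f) g = c * cinner f g"
    by transfer (simp add: l2_rel_def cinner_scaleC_left)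
  have "cinner f f = of_real (inner f f)"
    by transfer (simp add: cinner_self power2_norm_eq_inner)
  moreover have "0 \<le> inner f f" by transfer simp
  ultimately show "cinner f f = of_real ((norm f)\<^sup>2)" by (simp add: norm_l2_def)
qed (rule uniformity_l2_def open_l2_def)+

end

lemma square_integrable_rep: "square_integrable (rep_l2 f)"
  using Quotient3_rep_reflp[OF Quotient3_l2] by (auto simp: l2_rel_def)

lemma rep_abs_l2: "square_integrable f \<Longrightarrow> AE w in lebesgue. rep_l2 (abs_l2 f) w = f w"
  using rep_abs_rsp_left[OF Quotient3_l2, of f f] by (simp add: l2_rel_def)

lemma abs_rep_l2: "abs_l2 (rep_l2 f) = f"
  by (rule Quotient3_abs_rep[OF Quotient3_l2])

lemma norm_abs_l2:
  assumes "square_integrable f"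
  shows "(norm (abs_l2 f))\<^sup>2 = integral\<^sup>L lebesgue (\<lambda>w. (norm (f w))\<^sup>2)"
proof -
  have "l2_rel f f" using assms by (simp add: l2_rel_def)
  then have "inner (abs_l2 f) (abs_l2 f) = integral\<^sup>L lebesgue (\<lambda>w. inner (f w) (f w))"
    by (simp add: inner_l2.abs_eq)
  then show ?thesis by (simp add: power2_norm_eq_inner)
qed

lemma abs_diff_l2:
  assumes "square_integrable f" "square_integrable g"
  shows "abs_l2 f - abs_l2 g = abs_l2 (\<lambda>w. f w - g w)"
  using assms by (simp add: l2_rel_def minus_l2.abs_eq)

instance l2 :: (finite) banach
proof
  fix X :: "nat \<Rightarrow> 'a l2"
  assume X: "Cauchy X"
  have "\<forall>n. \<exists>N. \<forall>i\<ge>N. \<forall>j\<ge>N. dist (X i) (X j) < (1/4)^n"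
    using X unfolding Cauchy_def by simp
  then obtain N where N: "\<And>n i j. i \<ge> N n \<Longrightarrow> j \<ge> N n \<Longrightarrow> dist (X i) (X j) < (1/4)^n"
    by metis
  define k where "k n = (\<Sum>i\<le>n. N i)" for n
  have kN: "k n \<ge> N n" for n unfolding k_def by (simp add: member_le_sum)
  have k_mono: "n \<le> m \<Longrightarrow> k n \<le> k m" for n m unfolding k_def by (intro sum_mono2) auto
  have k_ge: "n \<le> m \<Longrightarrow> N n \<le> k m" for n m using kN[of n] k_mono[of n m] by linarith
  define F where "F n = rep_l2 (X (k n))" for n
  have sqF: "square_integrable (F n)" for n by (simp add: F_def square_integrable_rep)
  have mF [measurable]: "F n \<in> borel_measurable lebesgue" for n
    using sqF by (simp add: square_integrable_def)
  have absF: "abs_l2 (F n) = X (k n)" for n by (simp add: F_def abs_rep_l2)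
  have est: "(\<integral>\<^sup>+w. ennreal ((norm (F m w - F n w))\<^sup>2) \<partial>lebesgue) \<le> ennreal ((1/16)^n)"
    if "n \<le> m" for m n
  proof -
    have sq: "square_integrable (\<lambda>w. F m w - F n w)" by (intro square_integrable_diff sqF)
    have "(\<integral>\<^sup>+w. ennreal ((norm (F m w - F n w))\<^sup>2) \<partial>lebesgue)
        = ennreal (integral\<^sup>L lebesgue (\<lambda>w. (norm (F m w - F n w))\<^sup>2))"
      using sq by (intro nn_integral_eq_integral) (auto simp: square_integrable_def)
    also have "\<dots> = ennreal ((norm (X (k m) - X (k n)))\<^sup>2)"
      using norm_abs_l2[OF sq] abs_diff_l2[OF sqF sqF, of m n] by (simp add: absF)
    also have "(norm (X (k m) - X (k n)))\<^sup>2 \<le> ((1/4)^n)\<^sup>2"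
      using N[of n "k m" "k n"] k_ge[OF that] kN[of n] by (intro power_mono) (auto simp: dist_norm)
    also have "((1/4::real)^n)\<^sup>2 = (1/16)^n"
      by (simp add: power2_eq_square power_mult_distrib[symmetric])
    finally show ?thesis by (auto intro: ennreal_leI)
  qed
  define d where "d n w = F (Suc n) w - F n w" for n w
  have [measurable]: "d n \<in> borel_measurable lebesgue" for n unfolding d_def by measurable
  have "(\<integral>\<^sup>+w. (\<Sum>n. ennreal (4^n * (norm (d n w))\<^sup>2)) \<partial>lebesgue)
      = (\<Sum>n. \<integral>\<^sup>+w. ennreal (4^n * (norm (d n w))\<^sup>2) \<partial>lebesgue)"
    by (rule nn_integral_suminf) measurable
  also have "\<dots> \<le> (\<Sum>n. ennreal ((1/4)^n))"
  proof (rule suminf_le)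
    fix n
    have "(\<integral>\<^sup>+w. ennreal (4^n * (norm (d n w))\<^sup>2) \<partial>lebesgue)
        = ennreal (4^n) * (\<integral>\<^sup>+w. ennreal ((norm (d n w))\<^sup>2) \<partial>lebesgue)"
      by (subst ennreal_mult) (auto intro!: nn_integral_cmult)
    also have "\<dots> \<le> ennreal (4^n) * ennreal ((1/16)^n)"
      unfolding d_def by (intro mult_left_mono est) auto
    also have "\<dots> = ennreal ((1/4)^n)"
      by (simp add: ennreal_mult[symmetric] power_mult_distrib[symmetric])
    finally show "(\<integral>\<^sup>+w. ennreal (4^n * (norm (d n w))\<^sup>2) \<partial>lebesgue) \<le> ennreal ((1/4)^n)" .
  qed auto
  also have "\<dots> = ennreal (\<Sum>n. (1/4)^n)"
    by (rule suminf_ennreal2) (auto intro: summable_geometric)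
  finally have fin: "(\<integral>\<^sup>+w. (\<Sum>n. ennreal (4^n * (norm (d n w))\<^sup>2)) \<partial>lebesgue) \<noteq> \<infinity>"
    by (auto simp: top_unique)
  have "AE w in lebesgue. (\<Sum>n. ennreal (4^n * (norm (d n w))\<^sup>2)) \<noteq> \<infinity>"
    by (rule nn_integral_PInf_AE[OF _ fin]) measurable
  then have conv: "AE w in lebesgue. convergent (\<lambda>n. F n w)"
  proof eventually_elim
    case (elim w)
    then have "summable (\<lambda>n. 4^n * (norm (d n w))\<^sup>2)"
      by (intro summable_suminf_not_top) auto
    then have "Bseq (\<lambda>n. 4^n * (norm (d n w))\<^sup>2)"
      by (intro convergent_imp_Bseq convergentI[OF summable_LIMSEQ_zero])
    then obtain K where K: "K > 0" "\<And>n. 4^n * (norm (d n w))\<^sup>2 \<le> K"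
      by (auto simp: Bseq_def)
    have bd: "norm (d n w) \<le> sqrt K * (1/2)^n" for n
    proof (rule power2_le_imp_le)
      have "(norm (d n w))\<^sup>2 \<le> K * (1/4)^n"
        using K(2)[of n] by (simp add: field_simps power_one_over)
      also have "\<dots> = (sqrt K * (1/2)^n)\<^sup>2"
      proof -
        have "((1/2::real)^n)\<^sup>2 = (1/4)^n"
          by (simp add: power2_eq_square power_mult_distrib[symmetric])
        then show ?thesis using K(1) by (simp add: power_mult_distrib)
      qed
      finally show "(norm (d n w))\<^sup>2 \<le> (sqrt K * (1/2)^n)\<^sup>2" .
    qed (use K in auto)
    have "summable (\<lambda>n. d n w)"
      by (rule summable_comparison_test[of _ "\<lambda>n. sqrt K * (1/2)^n"])
         (use bd in \<open>auto intro!: summable_mult summable_geometric\<close>)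
    then have "convergent (\<lambda>n. \<Sum>i<n. d i w)" by (simp add: summable_iff_convergent)
    then have "convergent (\<lambda>n. (\<Sum>i<n. d i w) + F 0 w)"
      by (intro convergent_add convergent_const)
    moreover have "(\<Sum>i<n. d i w) + F 0 w = F n w" for n
      unfolding d_def by (induction n) (auto simp: algebra_simps)
    ultimately show "convergent (\<lambda>n. F n w)" by simp
  qed
  define G where "G w = lim (\<lambda>n. F n w)" for w
  have [measurable]: "G \<in> borel_measurable lebesgue"
    unfolding G_def by (intro borel_measurable_lim_metric) measurable
  have estG: "(\<integral>\<^sup>+w. ennreal ((norm (G w - F n w))\<^sup>2) \<partial>lebesgue) \<le> ennreal ((1/16)^n)" for n
  proof -
    have "(\<integral>\<^sup>+w. ennreal ((norm (G w - F n w))\<^sup>2) \<partial>lebesgue)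
        = (\<integral>\<^sup>+w. liminf (\<lambda>m. ennreal ((norm (F m w - F n w))\<^sup>2)) \<partial>lebesgue)"
    proof (rule nn_integral_cong_AE, use conv in eventually_elim)
      case (elim w)
      then have "(\<lambda>m. F m w) \<longlonglongrightarrow> G w" by (simp add: G_def convergent_LIMSEQ_iff)
      then have "(\<lambda>m. ennreal ((norm (F m w - F n w))\<^sup>2)) \<longlonglongrightarrow> ennreal ((norm (G w - F n w))\<^sup>2)"
        by (intro tendsto_intros)
      then show ?case by (rule lim_imp_Liminf[OF trivial_limit_sequentially, symmetric])
    qed
    also have "\<dots> \<le> liminf (\<lambda>m. \<integral>\<^sup>+w. ennreal ((norm (F m w - F n w))\<^sup>2) \<partial>lebesgue)"
      by (rule nn_integral_liminf) measurable
    also have "\<dots> \<le> ennreal ((1/16)^n)"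
      by (rule Liminf_le) (use est in \<open>auto simp: eventually_sequentially\<close>)
    finally show ?thesis .
  qed
  have sqD: "square_integrable (\<lambda>w. G w - F n w)" for n
    unfolding square_integrable_def
    by (intro conjI integrableI_bounded)
       (auto intro: le_less_trans[OF estG[of n]])
  have sqG: "square_integrable G"
    using square_integrable_add[OF sqD[of 0] sqF[of 0]] by simp
  have lim: "norm (abs_l2 G - X (k n)) \<le> (1/4)^n" for n
  proof (rule power2_le_imp_le)
    have "ennreal ((norm (abs_l2 G - X (k n)))\<^sup>2)
        = ennreal (integral\<^sup>L lebesgue (\<lambda>w. (norm (G w - F n w))\<^sup>2))"
      using norm_abs_l2[OF sqD] abs_diff_l2[OF sqG sqF] by (simp add: absF)
    also have "\<dots> = (\<integral>\<^sup>+w. ennreal ((norm (G w - F n w))\<^sup>2) \<partial>lebesgue)"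
      using sqD[of n] by (intro nn_integral_eq_integral[symmetric]) (auto simp: square_integrable_def)
    also have "\<dots> \<le> ennreal ((1/16)^n)" by (rule estG)
    also have "(1/16::real)^n = ((1/4)^n)\<^sup>2"
      by (simp add: power2_eq_square power_mult_distrib[symmetric])
    finally show "(norm (abs_l2 G - X (k n)))\<^sup>2 \<le> ((1/4)^n)\<^sup>2" by simp
  qed auto
  have "X \<longlonglongrightarrow> abs_l2 G"
  proof (rule metric_LIMSEQ_I)
    fix r :: real assume "0 < r"
    then obtain n where n: "(1/4::real)^n < r / 2"
      using real_arch_pow_inv[of "r/2" "1/4"] by auto
    have "dist (X i) (abs_l2 G) < r" if "i \<ge> k n" for i
    proof -
      have "dist (X i) (X (k n)) < (1/4)^n" using N[of n i "k n"] kN[of n] that by simp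
      moreover have "dist (X (k n)) (abs_l2 G) \<le> (1/4)^n"
        using lim[of n] by (simp add: dist_norm norm_minus_commute)
      ultimately show ?thesis using n dist_triangle[of "X i" "abs_l2 G" "X (k n)"] by linarith
    qed
    then show "\<exists>no. \<forall>n\<ge>no. dist (X n) (abs_l2 G) < r" by blast
  qed
  then show "convergent X" by (rule convergentI)
qed

section \<open>Operators on a subspace\<close>

text \<open>
  The Hilbert space L2 of an interval is a closed subspace H of \<open>'p l2\<close>, so an operator on H is a
  function on \<open>'p l2\<close> of which only the values on H matter.
\<close>

definition L2_interval :: "real \<Rightarrow> 'p::finite l2 set" where
  "L2_interval l = {f. AE w in lebesgue. w \<notin> {-l..l} \<longrightarrow> rep_l2 f w = 0}"

definition bounded_op ::
  "'a::complex_inner set \<Rightarrow> 'b::complex_inner set \<Rightarrow> ('a \<Rightarrow> 'b) \<Rightarrow> bool" where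
  "bounded_op V W X \<longleftrightarrow>
     (\<forall>f\<in>V. X f \<in> W) \<and>
     (\<forall>f\<in>V. \<forall>g\<in>V. X (f + g) = X f + X g) \<and>
     (\<forall>c. \<forall>f\<in>V. X (c *\<^sub>C f) = c *\<^sub>C X f) \<and>
     (\<exists>K. \<forall>f\<in>V. norm (X f) \<le> K * norm f)"

text \<open>The adjoint of an operator defined on \<open>V\<close>; \<open>cinner\<close> is linear in its first argument.\<close>

definition adj_op ::
  "'a::complex_inner set \<Rightarrow> ('a \<Rightarrow> 'b::complex_inner) \<Rightarrow> 'b \<Rightarrow> 'a" where
  "adj_op V X y = (THE h. h \<in> V \<and> (\<forall>f\<in>V. cinner (X f) y = cinner f h))"

definition unitary_op :: "'a::complex_inner set \<Rightarrow> ('a \<Rightarrow> 'a) \<Rightarrow> bool" where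
  "unitary_op V U \<longleftrightarrow>
     bounded_op V V U \<and> U ` V = V \<and> (\<forall>f\<in>V. \<forall>g\<in>V. cinner (U f) (U g) = cinner f g)"

definition selfadjoint_op :: "'a::complex_inner set \<Rightarrow> ('a \<Rightarrow> 'a) \<Rightarrow> bool" where
  "selfadjoint_op V X \<longleftrightarrow> bounded_op V V X \<and> (\<forall>f\<in>V. \<forall>g\<in>V. cinner (X f) g = cinner f (X g))"

text \<open>Invertibility means having a bounded inverse; the inverse on \<open>V\<close> is then \<open>inv_into V X\<close>.\<close>

definition invertible_op :: "'a::complex_inner set \<Rightarrow> ('a \<Rightarrow> 'a) \<Rightarrow> bool" where
  "invertible_op V X \<longleftrightarrow> (\<forall>f\<in>V. X f \<in> V) \<and>
     (\<exists>Y. bounded_op V V Y \<and> (\<forall>f\<in>V. X (Y f) = f \<and> Y (X f) = f))"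

definition exp_op :: "('a::complex_inner \<Rightarrow> 'a) \<Rightarrow> 'a \<Rightarrow> 'a" where
  "exp_op X f = (\<Sum>n. (X ^^ n) f /\<^sub>R fact n)"

text \<open>\<open>exp_i s X\<close> is the operator \<open>e\<^bsup>isX\<^esup>\<close>.\<close>

definition exp_i :: "real \<Rightarrow> ('a::complex_inner \<Rightarrow> 'a) \<Rightarrow> 'a \<Rightarrow> 'a" where
  "exp_i s X = exp_op (\<lambda>f. (\<i> * of_real s) *\<^sub>C X f)"

text \<open>
  The integral over the half-line as the limit of the integrals over \<open>[0,R]\<close>. Applied to
  \<open>F(\<eta>)f\<close> for every vector f it is the strong integral of an operator function F.
\<close>

definition has_halfline_integral :: "(real \<Rightarrow> 'a::real_normed_vector) \<Rightarrow> 'a \<Rightarrow> bool" where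
  "has_halfline_integral F I \<longleftrightarrow>
     (\<forall>R\<ge>0. F integrable_on {0..R}) \<and> ((\<lambda>R. integral {0..R} F) \<longlongrightarrow> I) at_top"

section \<open>Matrices\<close>

definition hadj :: "complex ^ 'n ^ 'm \<Rightarrow> complex ^ 'm ^ 'n" where
  "hadj A = (\<chi> i j. cnj (A $ j $ i))"

text \<open>Eigenvalues are counted with multiplicity, as roots of \<open>det (xI - A)\<close>.\<close>

definition charpoly :: "complex ^ 'm ^ 'm \<Rightarrow> complex poly" where
  "charpoly A = det (\<chi> i j. (if i = j then [:0, 1:] else 0) - [:A $ i $ j:])"

definition num_pos_eigenvalues :: "complex ^ 'm ^ 'm \<Rightarrow> nat" where
  "num_pos_eigenvalues A =
     (\<Sum>\<mu> | 0 < \<mu> \<and> poly (charpoly A) (complex_of_real \<mu>) = 0. order (complex_of_real \<mu>) (charpoly A))"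

definition num_neg_eigenvalues :: "complex ^ 'm ^ 'm \<Rightarrow> nat" where
  "num_neg_eigenvalues A =
     (\<Sum>\<mu> | \<mu> < 0 \<and> poly (charpoly A) (complex_of_real \<mu>) = 0. order (complex_of_real \<mu>) (charpoly A))"

text \<open>
  The linear order on the index type fixes the block decomposition: \<open>index_pos i\<close> is the zero-based
  position of the index \<open>i\<close>, and the upper blocks consist of the first \<open>r\<close> positions.
\<close>

definition index_pos :: "'m::{finite, linorder} \<Rightarrow> nat" where
  "index_pos i = card {k. k < i}"

definition J1 :: "nat \<Rightarrow> complex ^ 'm::{finite, linorder} ^ 'm::{finite, linorder}" where
  "J1 r = (\<chi> i j. if i = j \<and> index_pos i < r then 1 else 0)"

definition J2 :: "nat \<Rightarrow> complex ^ 'm::{finite, linorder} ^ 'm::{finite, linorder}" where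
  "J2 r = (\<chi> i j. if i = j \<and> r \<le> index_pos i then 1 else 0)"

definition lower_left_block :: "nat \<Rightarrow> complex ^ 'm::{finite, linorder} ^ 'm::{finite, linorder} \<Rightarrow> bool" where
  "lower_left_block r S \<longleftrightarrow> (\<forall>i j. S $ i $ j \<noteq> 0 \<longrightarrow> r \<le> index_pos i \<and> index_pos j < r)"

text \<open>\<open>row_op K x\<close> is the row vector \<open>x = (x1, x2, x3)\<close> times the 3 by 3 block matrix \<open>K\<close>.\<close>

definition row_op :: "complex ^ 'm ^ 'm ^ 3 ^ 3 \<Rightarrow> complex ^ 'm ^ 3 \<Rightarrow> complex ^ 'm ^ 3" where
  "row_op K x = (\<chi> j. \<Sum>i\<in>UNIV. (x $ i) v* (K $ i $ j))"

definition sigmaA :: "real \<Rightarrow> complex ^ 'm ^ 'm \<Rightarrow> complex ^ 'm ^ 3 \<Rightarrow> complex ^ 'm ^ 3" where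
  "sigmaA b L = row_op (vector [vector [0, 0, b *\<^sub>R L],
                                vector [0, b *\<^sub>R L, 0],
                                vector [b *\<^sub>R L, 0, 0]])"

definition sigmaB :: "complex ^ 'm ^ 'm \<Rightarrow> complex ^ 'm ^ 3 \<Rightarrow> complex ^ 'm ^ 3" where
  "sigmaB L = row_op (vector [vector [L, 0, 0],
                              vector [0, 0, 0],
                              vector [0, 0, 0]])"

definition gamma_in :: "real \<Rightarrow> complex ^ 'm ^ 'm \<Rightarrow> complex ^ 'm ^ 3 \<Rightarrow> complex ^ 'm ^ 3" where
  "gamma_in b L = row_op (vector [vector [0, 0, 0],
                                  vector [0, 0, b *\<^sub>R L],
                                  vector [0, b *\<^sub>R L, 0]])"

section \<open>The triangular model\<close>

text \<open>
  \<open>P\<close> is the matrix function usually written as capital Pi. Vectors are rows, so a matrix acts by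
  \<open>v*\<close> from the right; \<open>channel\<close> and \<open>channel3\<close> are the operators Phi and Phi-tilde.
  The norm in the Hoelder condition is the Euclidean norm of the matrix entries; since the constant
  \<open>C\<close> is arbitrary, the choice of the matrix norm does not matter.
\<close>

definition triangular_data ::
  "real \<Rightarrow> nat \<Rightarrow> (real \<Rightarrow> complex ^ 'm::{finite, linorder} ^ 'p::finite)
    \<Rightarrow> complex ^ 'm::{finite, linorder} ^ 'm::{finite, linorder}
    \<Rightarrow> complex ^ 'm::{finite, linorder} ^ 'm::{finite, linorder} \<Rightarrow> bool" where
  "triangular_data l r P L S0 \<longleftrightarrow>
     0 < l \<and> CARD('p) \<le> CARD('m) \<and>
     invertible L \<and> hadj L = L \<and>
     r \<le> CARD('m) \<and> num_pos_eigenvalues L = r \<and> num_neg_eigenvalues L = CARD('m) - r \<and>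
     lower_left_block r S0 \<and> L = J1 r - J2 r + S0 + hadj S0 \<and>
     P \<in> borel_measurable (lebesgue_on {-l..l}) \<and>
     (\<exists>D. D \<in> sets lebesgue \<and> D \<subseteq> {-l..l} \<and> 0 < emeasure lebesgue D \<and>
        (\<forall>w\<in>D. inj (\<lambda>i. row i (P w)) \<and> vec.independent (rows (P w)))) \<and>
     (\<forall>w\<in>{-l..l}. trace (hadj (P w) ** P w) = 1 \<and>
        hadj (P w) ** P w ** J1 r = J1 r ** (hadj (P w) ** P w)) \<and>
     (\<exists>C \<alpha>. 0 < \<alpha> \<and> \<alpha> \<le> 1 \<and> (\<forall>w1\<in>{-l..l}. \<forall>w2\<in>{-l..l}.
        norm (hadj (P w1) ** P w1 - hadj (P w2) ** P w2) \<le> C * \<bar>w1 - w2\<bar> powr \<alpha>))"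

definition mult_op :: "real \<Rightarrow> 'p::finite l2 \<Rightarrow> 'p l2" where
  "mult_op l f = abs_l2 (\<lambda>w. if w \<in> {-l..l} then of_real w *s rep_l2 f w else 0)"

definition model_op ::
  "real \<Rightarrow> (real \<Rightarrow> complex ^ 'm::finite ^ 'p::finite)
    \<Rightarrow> complex ^ 'm ^ 'm \<Rightarrow> complex ^ 'm ^ 'm \<Rightarrow> 'p l2 \<Rightarrow> 'p l2" where
  "model_op l P L S0 f = abs_l2 (\<lambda>w. if w \<in> {-l..l} then
       of_real w *s rep_l2 f w
       - \<i> *s (LINT \<xi>:{-l..w}|lebesgue. rep_l2 f \<xi> v* P \<xi> v* hadj S0 v* hadj (P w))
       + \<i> *s (LINT \<xi>:{w..l}|lebesgue. rep_l2 f \<xi> v* P \<xi> v* S0 v* hadj (P w))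
       + \<i> *s (LINT \<xi>:{-l..w}|lebesgue. rep_l2 f \<xi> v* P \<xi> v* L v* hadj (P w))
     else 0)"

definition channel ::
  "real \<Rightarrow> (real \<Rightarrow> complex ^ 'm::finite ^ 'p::finite) \<Rightarrow> 'p l2 \<Rightarrow> complex ^ 'm" where
  "channel l P f = (LINT w:{-l..l}|lebesgue. rep_l2 f w v* P w)"

definition channel3 ::
  "real \<Rightarrow> (real \<Rightarrow> complex ^ 'm::finite ^ 'p::finite) \<Rightarrow> ('p l2 \<Rightarrow> 'p l2)
    \<Rightarrow> 'p l2 \<Rightarrow> complex ^ 'm ^ 3" where
  "channel3 l P Bs f = vector [channel l P f, channel l P (Bs f), channel l P (Bs (Bs f))]"

section \<open>Colligations\<close>

definition commutative_regular_colligation ::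
  "('a::complex_inner \<Rightarrow> 'a) \<Rightarrow> ('a \<Rightarrow> 'a) \<Rightarrow> 'a set \<Rightarrow> ('a \<Rightarrow> 'e::complex_inner)
    \<Rightarrow> ('e \<Rightarrow> 'e) \<Rightarrow> ('e \<Rightarrow> 'e) \<Rightarrow> ('e \<Rightarrow> 'e) \<Rightarrow> ('e \<Rightarrow> 'e) \<Rightarrow> bool" where
  "commutative_regular_colligation A B H \<Phi> sA sB \<gamma> \<gamma>' \<longleftrightarrow>
     bounded_op H H A \<and> bounded_op H H B \<and> bounded_op H UNIV \<Phi> \<and>
     selfadjoint_op UNIV sA \<and> selfadjoint_op UNIV sB \<and>
     selfadjoint_op UNIV \<gamma> \<and> selfadjoint_op UNIV \<gamma>' \<and>
     (\<forall>f\<in>H. A (B f) = B (A f)) \<and>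
     (\<forall>f\<in>H. (1 / \<i>) *\<^sub>C (A f - adj_op H A f) = adj_op H \<Phi> (sA (\<Phi> f))) \<and>
     (\<forall>f\<in>H. (1 / \<i>) *\<^sub>C (B f - adj_op H B f) = adj_op H \<Phi> (sB (\<Phi> f))) \<and>
     (\<forall>f\<in>H. sA (\<Phi> (adj_op H B f)) - sB (\<Phi> (adj_op H A f)) = \<gamma> (\<Phi> f)) \<and>
     (\<forall>f\<in>H. sA (\<Phi> (B f)) - sB (\<Phi> (A f)) = \<gamma>' (\<Phi> f)) \<and>
     (\<forall>y. \<gamma>' y = \<gamma> y + \<i> *\<^sub>C (sA (\<Phi> (adj_op H \<Phi> (sB y))) - sB (\<Phi> (adj_op H \<Phi> (sA y)))))"

end

theory Submission
  imports Defs
begin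

text \<open>
  Since \<open>B* = - U B U*\<close>, the operator \<open>i(tA + xB)\<close> is symmetric for the form \<open>(f, z) \<mapsto> \<langle>f, U z\<rangle>\<close>; hence
  \<open>T* = U T U*\<close> and \<open>\<Gamma> = T + T\<^sup>-\<^sup>1 N\<close> with \<open>N = U* M\<close>. The integrand \<open>F(\<eta>) = e\<^bsup>i\<eta>B\<^esup> D e\<^bsup>i\<eta>B\<^esup>\<close> of \<open>N\<close>,
  \<open>D = U* \<rho> (B - B*)/i\<close>, satisfies \<open>F' = iBF + FiB\<close>, so it has a limit at infinity, which must be zero;
  this gives the Sylvester equation \<open>iBN + NiB = - D\<close>. It turns \<open>\<Gamma> h = \<Gamma>\<^sub>x g - \<Gamma>(iBg)\<close> into
  \<open>\<Gamma> h = T\<^sup>-\<^sup>1 D g\<close>, that is \<open>h = T(-2x, -2t)(D g - N h)\<close>, and applying the channel operator after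
  \<open>e\<^bsup>i\<xi>B\<^esup>\<close> yields the claim.
\<close>

section \<open>The Banach algebra of bounded operators\<close>

text \<open>A type with a single parameter can carry composition as its multiplication; as a Banach
  algebra it admits \<open>exp\<close> and its calculus.\<close>

typedef (overloaded) 'a endo = "UNIV :: ('a::real_normed_vector \<Rightarrow>\<^sub>L 'a) set"
  morphisms blinfun_of_endo Endo
  by simp

setup_lifting type_definition_endo

instantiation endo :: (real_normed_vector) real_vector
begin

lift_definition zero_endo :: "'a endo" is 0 .
lift_definition plus_endo :: "'a endo \<Rightarrow> 'a endo \<Rightarrow> 'a endo" is "(+)" .
lift_definition minus_endo :: "'a endo \<Rightarrow> 'a endo \<Rightarrow> 'a endo" is "(-)" .
lift_definition uminus_endo :: "'a endo \<Rightarrow> 'a endo" is uminus .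
lift_definition scaleR_endo :: "real \<Rightarrow> 'a endo \<Rightarrow> 'a endo" is scaleR .

instance
  by standard (transfer; simp add: algebra_simps)+

end

instantiation endo :: (real_normed_vector) real_normed_vector
begin

lift_definition norm_endo :: "'a endo \<Rightarrow> real" is norm .
definition "dist (X::'a endo) Y = norm (X - Y)"
definition "sgn (X::'a endo) = X /\<^sub>R norm X"
definition [code del]:
  "(uniformity :: ('a endo \<times> 'a endo) filter) = (INF e\<in>{0<..}. principal {(X, Y). dist X Y < e})"
definition [code del]:
  "open (S :: 'a endo set) \<longleftrightarrow> (\<forall>X\<in>S. \<forall>\<^sub>F (X', Y) in uniformity. X' = X \<longrightarrow> Y \<in> S)"

instance
proof
  fix X Y :: "'a endo" and r :: real
  show "norm X = 0 \<longleftrightarrow> X = 0" "norm (X + Y) \<le> norm X + norm Y" "norm (r *\<^sub>R X) = \<bar>r\<bar> * norm X"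
    by (transfer; simp add: norm_triangle_ineq)+
qed (rule dist_endo_def sgn_endo_def uniformity_endo_def open_endo_def)+

end

instance endo :: (banach) banach
proof
  fix X :: "nat \<Rightarrow> 'a endo"
  assume "Cauchy X"
  then have "Cauchy (\<lambda>n. blinfun_of_endo (X n))"
    by (simp add: Cauchy_def dist_norm norm_endo.rep_eq minus_endo.rep_eq)
  then obtain Y where "(\<lambda>n. blinfun_of_endo (X n)) \<longlonglongrightarrow> Y"
    by (auto simp: Cauchy_convergent_iff convergent_def)
  then have "X \<longlonglongrightarrow> Endo Y"
    by (simp add: LIMSEQ_def dist_norm norm_endo.rep_eq minus_endo.rep_eq Endo_inverse)
  then show "convergent X"
    by (rule convergentI)
qed

text \<open>The sort \<open>perfect_space\<close> excludes the zero space, where the identity has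
  norm 0 and \<open>norm 1 = 1\<close> fails.\<close>

instantiation endo :: ("{real_normed_vector, perfect_space}") real_normed_algebra_1
begin

lift_definition one_endo :: "'a endo" is id_blinfun .
lift_definition times_endo :: "'a endo \<Rightarrow> 'a endo \<Rightarrow> 'a endo" is "(o\<^sub>L)" .

instance
proof
  fix X Y Z :: "'a endo" and r :: real
  show "X * Y * Z = X * (Y * Z)" "1 * X = X" "X * 1 = X"
    "(X + Y) * Z = X * Z + Y * Z" "X * (Y + Z) = X * Y + X * Z"
    "r *\<^sub>R X * Y = r *\<^sub>R (X * Y)" "X * r *\<^sub>R Y = r *\<^sub>R (X * Y)"
    by (transfer; auto intro!: blinfun_eqI simp: blinfun.bilinear_simps)+
  show "norm (X * Y) \<le> norm X * norm Y"
    by transfer (rule norm_blinfun_compose)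
  show norm_1: "norm (1 :: 'a endo) = 1"
    by transfer simp
  have "norm (0 :: 'a endo) = 0"
    by transfer simp
  with norm_1 show "(0 :: 'a endo) \<noteq> 1"
    by force
qed

end

section \<open>Evaluation of operators and of their exponentials at vectors\<close>

definition endo_app :: "'a::real_normed_vector endo \<Rightarrow> 'a \<Rightarrow> 'a" where
  "endo_app X = blinfun_apply (blinfun_of_endo X)"

lemma endo_app_simps [simp]:
  "endo_app 1 f = (f :: 'a::{real_normed_vector, perfect_space})"
  "endo_app (X * Y) f = endo_app X (endo_app Y f)"
  "endo_app (Y' + Z) f' = endo_app Y' f' + endo_app Z (f' :: 'b::real_normed_vector)"
  "endo_app (Y' - Z) f' = endo_app Y' f' - endo_app Z f'"
  "endo_app (- Z) f' = - endo_app Z f'"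
  "endo_app (r *\<^sub>R Z) f' = r *\<^sub>R endo_app Z f'"
  by (simp_all add: endo_app_def one_endo.rep_eq times_endo.rep_eq plus_endo.rep_eq
      minus_endo.rep_eq uminus_endo.rep_eq scaleR_endo.rep_eq blinfun.bilinear_simps)

lemma bounded_linear_endo_app: "bounded_linear (endo_app X)"
  by (simp add: endo_app_def blinfun.bounded_linear_right)

lemma bounded_linear_endo_app_left: "bounded_linear (\<lambda>X. endo_app X f)"
proof (rule bounded_linear_intro[where K = "norm f"])
  show "norm (endo_app X f) \<le> norm X * norm f" for X
    unfolding endo_app_def norm_endo.rep_eq by (rule norm_blinfun)
qed simp_all

lemma endo_app_Endo_Blinfun: "bounded_linear X \<Longrightarrow> endo_app (Endo (Blinfun X)) = X"
  by (simp add: endo_app_def Endo_inverse bounded_linear_Blinfun_apply)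

lemma endo_eqI: "(\<And>f. endo_app X f = endo_app Y f) \<Longrightarrow> X = Y"
  unfolding endo_app_def by (metis blinfun_eqI blinfun_of_endo_inject)

text \<open>Evaluation at a fixed vector is bounded linear in the operator, so it passes through the
  exponential series. The vector form matches the definition of \<open>exp_op\<close>.\<close>

lemma endo_app_exp_sums:
  fixes X :: "'a::{banach, perfect_space} endo"
  shows "(\<lambda>n. endo_app (X ^ n) f /\<^sub>R fact n) sums endo_app (exp X) f"
proof -
  have "(\<lambda>n. X ^ n /\<^sub>R fact n) sums exp X"
    unfolding exp_def by (rule summable_sums[OF summable_exp_generic])
  from bounded_linear.sums[OF bounded_linear_endo_app_left this] show ?thesis
    by simp
qed

text \<open>Since \<open>X\<close> and \<open>Y\<close> commute, the exponential splits, and only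
  the factor with exponent \<open>s *\<^sub>R X\<close> depends on \<open>s\<close>. The summand
  \<open>Y\<close> holds the other variable in partial derivatives of \<open>T(x,t)\<close>.\<close>

lemma endo_app_exp_scaleR_vector_derivative:
  fixes X Y :: "'a::{banach, perfect_space} endo"
  assumes "X * Y = Y * X"
  shows "((\<lambda>s. endo_app (exp (Y + s *\<^sub>R X)) f) has_vector_derivative
     endo_app (X * exp (Y + s *\<^sub>R X)) f) (at s within S)"
proof -
  have split: "exp (Y + s *\<^sub>R X) = exp (s *\<^sub>R X) * exp Y" for s
    using assms by (subst add.commute, intro exp_add_commuting) simp
  have "((\<lambda>s. endo_app (exp (s *\<^sub>R X)) (endo_app (exp Y) f)) has_vector_derivative
     endo_app (X * exp (s *\<^sub>R X)) (endo_app (exp Y) f)) (at s within S)"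
    by (intro bounded_linear.has_vector_derivative[OF bounded_linear_endo_app_left]
        has_vector_derivative_at_within[OF exp_scaleR_has_vector_derivative_left])
  then show ?thesis
    by (simp add: split)
qed

section \<open>Hilbert space\<close>

lemma scaleC_minus_right: "c *\<^sub>C (- f) = - (c *\<^sub>C (f :: 'a::complex_inner))"
proof -
  have "c *\<^sub>C (- f) = c *\<^sub>C (complex_of_real (-1) *\<^sub>C f)"
    by (simp only: scaleC_of_real) simp
  also have "\<dots> = complex_of_real (-1) *\<^sub>C (c *\<^sub>C f)"
    unfolding scaleC_scaleC by (simp add: mult.commute)
  finally show ?thesis
    by (simp only: scaleC_of_real) simp
qed

lemma scaleC_scaleR_commute: "c *\<^sub>C (r *\<^sub>R f) = r *\<^sub>R (c *\<^sub>C (f :: 'a::complex_inner))"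
  by (simp only: scaleC_of_real[symmetric] scaleC_scaleC mult.commute)

text \<open>Polarisation: \<open>inner\<close> and the real part of \<open>cinner\<close> are
  symmetric real bilinear forms with the same squared norm, which ties the two structures
  together.\<close>

lemma Re_cinner: "Re (cinner f g) = inner f (g :: 'a::complex_inner)"
proof -
  have add: "cinner h (f + g) = cinner h f + cinner h g" for h
    by (metis cinner_add_left cinner_commute complex_cnj_add)
  have "cinner (f + g) (f + g) = cinner f f + (cinner f g + cinner g f) + cinner g g"
    by (simp add: cinner_add_left add algebra_simps)
  then have "(norm (f + g))\<^sup>2 = (norm f)\<^sup>2 + 2 * Re (cinner f g) + (norm g)\<^sup>2"
    using cinner_commute[of g f] by (simp add: cinner_self complex_eq_iff)
  then show ?thesis
    using dot_norm[of f g] by simp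
qed

text \<open>The imaginary part of a complex number is the real part of its product with
  \<open>- \<i>\<close>. This carries estimates and representation theorems from
  \<open>inner\<close> to \<open>cinner\<close>.\<close>

lemma cinner_eq_inner: "cinner f g = Complex (inner f g) (inner ((- \<i>) *\<^sub>C f) (g :: 'a::complex_inner))"
proof -
  have "Im (cinner f g) = Re (cinner ((- \<i>) *\<^sub>C f) g)"
    by (simp add: cinner_scaleC_left)
  then show ?thesis
    by (simp only: complex_eq_iff Re_cinner complex.sel simp_thms)
qed

lemma bounded_linear_cinner_left: "bounded_linear (\<lambda>f. cinner f (g :: 'a::complex_inner))"
proof (rule bounded_linear_intro[where K = "2 * norm g"])
  show "cinner (f + f') g = cinner f g + cinner f' g" for f f'
    by (rule cinner_add_left)
  show "cinner (r *\<^sub>R f) g = r *\<^sub>R cinner f g" for r f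
    using cinner_scaleC_left[of "of_real r" f g] by (simp add: scaleC_of_real scaleR_conv_of_real)
  show "norm (cinner f g) \<le> norm f * (2 * norm g)" for f
    using cmod_le[of "cinner f g"] Cauchy_Schwarz_ineq2[of f g] Cauchy_Schwarz_ineq2[of "(- \<i>) *\<^sub>C f" g]
    by (simp add: cinner_eq_inner norm_scaleC)
qed

lemma bounded_linear_cinner_right: "bounded_linear (\<lambda>g. cinner (f :: 'a::complex_inner) g)"
  using bounded_linear_compose[OF bounded_linear_cnj bounded_linear_cinner_left[of f]]
  by (simp flip: cinner_commute)

lemma cinner_scaleC_right: "cinner (f :: 'a::complex_inner) (c *\<^sub>C g) = cnj c * cinner f g"
  by (metis cinner_commute cinner_scaleC_left complex_cnj_mult)

lemma scaleC_mult_of_real: "(c * of_real r) *\<^sub>C f = r *\<^sub>R c *\<^sub>C (f :: 'a::complex_inner)"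
  by (simp add: scaleC_of_real scaleC_scaleR_commute flip: scaleC_scaleC)

text \<open>The representing vector minimises \<open>(norm f)\<^sup>2 - 2 * \<phi> f\<close>; minimising sequences are Cauchy by
  the parallelogram law.\<close>

lemma Riesz_representation_closed_subspace:
  fixes V :: "'a::{real_inner, complete_space} set"
  assumes V: "subspace V" "closed V"
    and add: "\<And>f g. f \<in> V \<Longrightarrow> g \<in> V \<Longrightarrow> \<phi> (f + g) = \<phi> f + \<phi> g"
    and scale: "\<And>r f. f \<in> V \<Longrightarrow> \<phi> (r *\<^sub>R f) = r * \<phi> f"
    and bound: "\<And>f. f \<in> V \<Longrightarrow> \<bar>\<phi> f\<bar> \<le> K * norm f"
  shows "\<exists>h\<in>V. \<forall>f\<in>V. \<phi> f = inner f h"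
proof -
  define Q where "Q f = (norm f)\<^sup>2 - 2 * \<phi> f" for f
  have lower: "- K\<^sup>2 \<le> Q f" if "f \<in> V" for f
  proof -
    have "0 \<le> (norm f - K)\<^sup>2"
      by simp
    also have "\<dots> = (norm f)\<^sup>2 - 2 * (K * norm f) + K\<^sup>2"
      by (simp add: power2_eq_square algebra_simps)
    finally show ?thesis
      using bound[OF that] by (simp add: Q_def)
  qed
  have bdd: "bdd_below (Q ` V)"
    by (rule bdd_belowI2[of _ "- K\<^sup>2"]) (rule lower)
  define d where "d = Inf (Q ` V)"
  have d_le: "d \<le> Q f" if "f \<in> V" for f
    unfolding d_def using bdd that by (intro cInf_lower) auto
  have "0 \<in> V"
    using V(1) by (rule subspace_0)
  have "\<exists>f\<in>V. Q f < d + inverse (real (Suc n))" for n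
    using cInf_lessD[of "Q ` V" "d + inverse (real (Suc n))"] \<open>0 \<in> V\<close> by (auto simp: d_def)
  then obtain F where F: "F n \<in> V" "Q (F n) < d + inverse (real (Suc n))" for n
    by metis
  have par: "(norm (f - g))\<^sup>2 \<le> 2 * (Q f - d) + 2 * (Q g - d)" if "f \<in> V" "g \<in> V" for f g
  proof -
    have mid: "(1/2) *\<^sub>R (f + g) \<in> V"
      using V(1) that by (intro subspace_scale subspace_add)
    have "4 * Q ((1/2) *\<^sub>R (f + g)) = (norm (f + g))\<^sup>2 - 4 * (\<phi> f + \<phi> g)"
      using that V(1) by (simp add: Q_def scale add subspace_add power_divide add_divide_distrib)
    also have "(norm (f + g))\<^sup>2 = 2 * (norm f)\<^sup>2 + 2 * (norm g)\<^sup>2 - (norm (f - g))\<^sup>2"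
      by (simp add: power2_norm_eq_inner inner_add inner_diff inner_commute)
    finally show ?thesis
      using d_le[OF mid] by (simp add: Q_def)
  qed
  have "Cauchy F"
  proof (rule metric_CauchyI)
    fix e :: real
    assume "0 < e"
    \<comment> \<open>By \<open>par\<close>, two excesses below \<open>e\<^sup>2 / 4\<close> keep
      the squared distance below \<open>e\<^sup>2\<close>.\<close>
    then obtain N where N: "inverse (real (Suc N)) < e\<^sup>2 / 4"
      using reals_Archimedean[of "e\<^sup>2 / 4"] by auto
    have small: "Q (F n) - d < e\<^sup>2 / 4" if "N \<le> n" for n
    proof -
      have "inverse (real (Suc n)) \<le> inverse (real (Suc N))"
        using that by (intro le_imp_inverse_le) auto
      then show ?thesis
        using F(2)[of n] N by linarith
    qed
    have "dist (F m) (F n) < e" if "N \<le> m" "N \<le> n" for m n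
    proof (rule power2_less_imp_less)
      show "(dist (F m) (F n))\<^sup>2 < e\<^sup>2"
        using par[OF F(1) F(1), of m n] small[OF that(1)] small[OF that(2)] by (simp add: dist_norm)
    qed (use \<open>0 < e\<close> in simp)
    then show "\<exists>N. \<forall>m\<ge>N. \<forall>n\<ge>N. dist (F m) (F n) < e"
      by blast
  qed
  then obtain h where lim: "F \<longlonglongrightarrow> h"
    by (auto simp: Cauchy_convergent_iff convergent_def)
  have h: "h \<in> V"
    using closed_sequentially[OF V(2) _ lim] F(1) by blast
  have "(\<lambda>n. \<phi> (F n) - \<phi> h) \<longlonglongrightarrow> 0"
  proof (rule Lim_null_comparison)
    have "\<phi> (F n) = \<phi> (F n - h) + \<phi> h" for n
      using add[of "F n - h" h] F(1) h V(1) by (simp add: subspace_diff)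
    then show "\<forall>\<^sub>F n in sequentially. norm (\<phi> (F n) - \<phi> h) \<le> K * norm (F n - h)"
      using bound F(1) h V(1) by (simp add: subspace_diff)
    show "(\<lambda>n. K * norm (F n - h)) \<longlonglongrightarrow> 0"
      using lim by (intro tendsto_mult_right_zero tendsto_norm_zero LIM_zero)
  qed
  then have "(\<lambda>n. \<phi> (F n)) \<longlonglongrightarrow> \<phi> h"
    by (rule LIM_zero_cancel)
  then have "(\<lambda>n. Q (F n)) \<longlonglongrightarrow> Q h"
    unfolding Q_def using lim by (intro tendsto_intros)
  moreover have "(\<lambda>n. d + inverse (real (Suc n))) \<longlonglongrightarrow> d + 0"
    by (intro tendsto_intros LIMSEQ_inverse_real_of_nat)
  ultimately have Qh: "Q h \<le> d"
    using F(2) by (intro LIMSEQ_le[of "\<lambda>n. Q (F n)" _ "\<lambda>n. d + inverse (real (Suc n))"])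
      (auto intro: less_imp_le)
  have "\<phi> f = inner f h" if f: "f \<in> V" for f
  proof (rule ccontr)
    assume "\<phi> f \<noteq> inner f h"
    define c where "c = \<phi> f - inner f h"
    \<comment> \<open>A step along \<open>f\<close> that pushes \<open>Q\<close> below its infimum:
      the linear gain \<open>2 * s * c\<close> beats the quadratic cost. The summand 1 keeps the
      denominator positive.\<close>
    define s where "s = c / (1 + (norm f)\<^sup>2)"
    have "0 < 1 + (norm f)\<^sup>2"
      by (simp add: add_pos_nonneg)
    have "(norm (h + s *\<^sub>R f))\<^sup>2 = (norm h)\<^sup>2 + 2 * s * inner f h + s\<^sup>2 * (norm f)\<^sup>2"
      unfolding power2_norm_eq_inner
      by (simp add: inner_add inner_commute[of h f] power2_eq_square algebra_simps)
    then have "Q (h + s *\<^sub>R f) = Q h - 2 * s * c + s\<^sup>2 * (norm f)\<^sup>2"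
      using f h V(1) by (simp add: Q_def add scale subspace_scale c_def algebra_simps)
    moreover have "d \<le> Q (h + s *\<^sub>R f)"
      using f h V(1) by (intro d_le subspace_add subspace_scale)
    ultimately have "2 * s * c \<le> s\<^sup>2 * (norm f)\<^sup>2"
      using Qh by linarith
    also have "\<dots> \<le> s * (s * (1 + (norm f)\<^sup>2))"
      by (simp add: power2_eq_square algebra_simps)
    also have "s * (1 + (norm f)\<^sup>2) = c"
      using \<open>0 < 1 + (norm f)\<^sup>2\<close> by (simp add: s_def)
    finally have "s * c \<le> 0"
      by linarith
    moreover have "0 < s * c"
      using \<open>0 < 1 + (norm f)\<^sup>2\<close> \<open>\<phi> f \<noteq> inner f h\<close>
      by (auto simp: s_def c_def divide_simps zero_less_mult_iff)
    ultimately show False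
      by linarith
  qed
  then show ?thesis
    using h by blast
qed

text \<open>The orthogonal projection: \<open>R f\<close> represents the functional
  \<open>\<lambda>g. inner g f\<close> on \<open>V\<close>, and uniqueness of the representing
  vector yields linearity. It serves to extend operators from \<open>V\<close> to the whole
  space.\<close>

lemma bounded_linear_projection:
  fixes V :: "'a::{real_inner, complete_space} set"
  assumes V: "subspace V" "closed V"
  obtains R where "bounded_linear R" "\<And>f. R f \<in> V" "\<And>f. f \<in> V \<Longrightarrow> R f = f"
proof -
  have "\<exists>h\<in>V. \<forall>g\<in>V. inner g f = inner g h" for f
  proof (rule Riesz_representation_closed_subspace[OF V, where \<phi> = "\<lambda>g. inner g f" and K = "norm f"])
    show "\<bar>inner g f\<bar> \<le> norm f * norm g" for g
      using Cauchy_Schwarz_ineq2[of g f] by (simp add: mult.commute)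
  qed (simp_all add: inner_add_left)
  then obtain R where R: "R f \<in> V" "g \<in> V \<Longrightarrow> inner g f = inner g (R f)" for f g
    by metis
  have uniq: "R f = h" if "h \<in> V" "\<And>g. g \<in> V \<Longrightarrow> inner g f = inner g h" for f h
  proof -
    have "R f - h \<in> V"
      using R(1) that(1) V(1) by (intro subspace_diff)
    then have "inner (R f - h) (R f - h) = 0"
      using that(2) by (simp add: inner_diff_right R(2)[symmetric])
    then show ?thesis
      by simp
  qed
  have "bounded_linear R"
  proof (rule bounded_linear_intro[where K = 1])
    show "R (f + g) = R f + R g" for f g
      using R(1) V(1) by (intro uniq) (simp_all add: inner_add_right subspace_add R(2)[symmetric])
    show "R (r *\<^sub>R f) = r *\<^sub>R R f" for r f
      using R(1) V(1) by (intro uniq) (simp_all add: subspace_scale R(2)[symmetric])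
    show "norm (R f) \<le> norm f * 1" for f
    proof -
      have "(norm (R f))\<^sup>2 = inner (R f) f"
        by (simp add: power2_norm_eq_inner R(1) R(2)[symmetric])
      also have "\<dots> \<le> norm (R f) * norm f"
        by (rule norm_cauchy_schwarz)
      finally show ?thesis
        by (cases "R f = 0") (auto simp: power2_eq_square)
    qed
  qed
  moreover have "R f = f" if "f \<in> V" for f
    using that by (intro uniq) auto
  ultimately show ?thesis
    using R(1) that by blast
qed

section \<open>Integrals over the half-line\<close>

text \<open>A bounded linear map commutes with each integral over [0,R] and, being continuous, with
  the limit. It moves operators in and out of strong integrals.\<close>

lemma has_halfline_integral_bounded_linear:
  assumes "has_halfline_integral F I" "bounded_linear h"
  shows "has_halfline_integral (\<lambda>\<eta>. h (F \<eta>)) (h I)"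
proof -
  have F: "F integrable_on {0..R}" if "0 \<le> R" for R
    using assms(1) that by (simp add: has_halfline_integral_def)
  have eq: "h (integral {0..R} F) = integral {0..R} (\<lambda>\<eta>. h (F \<eta>))" if "0 \<le> R" for R
    using integral_linear[OF F[OF that] assms(2)] by (simp add: o_def)
  have "((\<lambda>R. h (integral {0..R} F)) \<longlongrightarrow> h I) at_top"
    using assms by (intro bounded_linear.tendsto[OF assms(2)]) (simp add: has_halfline_integral_def)
  then have "((\<lambda>R. integral {0..R} (\<lambda>\<eta>. h (F \<eta>))) \<longlongrightarrow> h I) at_top"
    by (rule Lim_transform_eventually) (use eventually_ge_at_top[of 0] in eventually_elim, rule eq)
  then show ?thesis
    using integrable_linear[OF F assms(2)] by (simp add: has_halfline_integral_def o_def)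
qed

lemma has_halfline_integral_add:
  assumes "has_halfline_integral F I" "has_halfline_integral G J"
  shows "has_halfline_integral (\<lambda>\<eta>. F \<eta> + G \<eta>) (I + J)"
proof -
  have int: "F integrable_on {0..R}" "G integrable_on {0..R}" if "0 \<le> R" for R
    using assms that by (auto simp: has_halfline_integral_def)
  have "((\<lambda>R. integral {0..R} F + integral {0..R} G) \<longlongrightarrow> I + J) at_top"
    using assms by (intro tendsto_add) (auto simp: has_halfline_integral_def)
  then have "((\<lambda>R. integral {0..R} (\<lambda>\<eta>. F \<eta> + G \<eta>)) \<longlongrightarrow> I + J) at_top"
    by (rule Lim_transform_eventually)
      (use eventually_ge_at_top[of 0] in eventually_elim, simp add: integral_add int)
  then show ?thesis
    using int by (simp add: has_halfline_integral_def integrable_add)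
qed

text \<open>Integrals over the unit windows [R,R+1] are differences of a convergent function of R,
  so they tend to zero; yet they also approach \<open>c\<close>.\<close>

lemma halfline_integrable_limit_zero:
  fixes F :: "real \<Rightarrow> 'a::banach"
  assumes F: "has_halfline_integral F I" and c: "(F \<longlongrightarrow> c) at_top"
  shows "c = 0"
proof (rule ccontr)
  assume "c \<noteq> 0"
  have int: "F integrable_on {0..R}" if "0 \<le> R" for R
    using F that by (simp add: has_halfline_integral_def)
  have "((\<lambda>R. integral {0..R} F) \<longlongrightarrow> I) at_top"
    using F by (simp add: has_halfline_integral_def)
  moreover have "filterlim (\<lambda>R::real. R + 1) at_top at_top"
    using filterlim_tendsto_add_at_top[OF tendsto_const filterlim_ident, of "1::real"] by (simp add: add.commute)
  ultimately have "((\<lambda>R. integral {0..R + 1} F - integral {0..R} F) \<longlongrightarrow> I - I) at_top"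
    by (intro tendsto_diff filterlim_compose[where g = "\<lambda>R. integral {0..R} F" and f = "\<lambda>R. R + 1"])
  from tendstoD[OF this, of "norm c / 2"]
  have small: "\<forall>\<^sub>F R in at_top. norm (integral {0..R + 1} F - integral {0..R} F) < norm c / 2"
    using \<open>c \<noteq> 0\<close> by (simp add: dist_norm)
  have "\<forall>\<^sub>F R in at_top. norm (F R - c) < norm c / 2"
    using tendstoD[OF c, of "norm c / 2"] \<open>c \<noteq> 0\<close> by (simp add: dist_norm)
  then obtain R0 where R0: "\<And>R. R0 \<le> R \<Longrightarrow> norm (F R - c) < norm c / 2"
    by (auto simp: eventually_at_top_linorder)
  have "\<forall>\<^sub>F R in at_top. max 0 R0 \<le> R"
    by (rule eventually_ge_at_top)
  with small have "\<forall>\<^sub>F R::real in at_top. False"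
  proof eventually_elim
    case (elim R)
    have intR: "F integrable_on {R..R + 1}"
      by (rule integrable_on_subinterval[OF int[of "R + 1"]]) (use elim in auto)
    have "integral {0..R + 1} F = integral {0..R} F + integral {R..R + 1} F"
      using elim by (intro Henstock_Kurzweil_Integration.integral_combine[symmetric] int) auto
    \<comment> \<open>On a window of length 1 the integral deviates from \<open>c\<close> by no more
      than the values do. Together with \<open>small\<close> this contradicts the triangle
      inequality.\<close>
    moreover have "norm (integral {R..R + 1} F - c) \<le> norm c / 2"
    proof -
      have "((\<lambda>s. F s - c) has_integral (integral {R..R + 1} F - c)) {R..R + 1}"
        using has_integral_diff[OF integrable_integral[OF intR] has_integral_const_real[of c R "R + 1"]]
        by simp
      then have "norm (integral {R..R + 1} F - c) \<le> norm c / 2 * measure lborel {R..R + 1}"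
      proof (rule has_integral_bound_real[where S = "{}", rotated 2])
        show "norm (F s - c) \<le> norm c / 2" if "s \<in> {R..R + 1} - {}" for s
          using R0[of s] elim that by simp
      qed simp_all
      then show ?thesis
        by simp
    qed
    moreover have "norm c \<le> norm (integral {R..R + 1} F) + norm (integral {R..R + 1} F - c)"
      using norm_triangle_ineq4[of "integral {R..R + 1} F" "integral {R..R + 1} F - c"] by simp
    ultimately show False
      using elim by simp
  qed
  then show False
    by simp
qed

text \<open>The integrand has derivative \<open>Z F + F Z\<close>; it therefore converges at infinity, and its
  limit is zero because it is integrable.\<close>

lemma Sylvester_equation_halfline:
  fixes Z D :: "'a::{banach, perfect_space} endo"
  assumes f: "has_halfline_integral (\<lambda>\<eta>. endo_app (exp (\<eta> *\<^sub>R Z) * D * exp (\<eta> *\<^sub>R Z)) f) N"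
    and Zf: "has_halfline_integral (\<lambda>\<eta>. endo_app (exp (\<eta> *\<^sub>R Z) * D * exp (\<eta> *\<^sub>R Z)) (endo_app Z f)) N'"
  shows "endo_app Z N + N' = - endo_app D f"
proof -
  define F where "F \<eta> = exp (\<eta> *\<^sub>R Z) * D * exp (\<eta> *\<^sub>R Z)" for \<eta>
  define G where "G \<eta> = endo_app Z (endo_app (F \<eta>) f) + endo_app (F \<eta>) (endo_app Z f)" for \<eta>
  have deriv: "((\<lambda>\<eta>. endo_app (F \<eta>) f) has_vector_derivative G \<eta>) (at \<eta> within S)" for \<eta> S
  proof -
    have "(F has_vector_derivative
        exp (\<eta> *\<^sub>R Z) * D * (exp (\<eta> *\<^sub>R Z) * Z) + (Z * exp (\<eta> *\<^sub>R Z) * D) * exp (\<eta> *\<^sub>R Z)) (at \<eta> within S)"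
      unfolding F_def
      by (intro has_vector_derivative_mult has_vector_derivative_mult_left
          has_vector_derivative_at_within[OF exp_scaleR_has_vector_derivative_right]
          has_vector_derivative_at_within[OF exp_scaleR_has_vector_derivative_left])
    from bounded_linear.has_vector_derivative[OF bounded_linear_endo_app_left this, of f] show ?thesis
      by (simp add: G_def F_def add.commute)
  qed
  \<comment> \<open>The integral is a strong one: \<open>Z\<close> on the left leaves it by
    continuity, while \<open>Z\<close> on the right changes the vector, whence the separate value
    \<open>N'\<close>.\<close>
  have "has_halfline_integral G (endo_app Z N + N')"
    unfolding G_def F_def
    by (rule has_halfline_integral_add[OF has_halfline_integral_bounded_linear[OF f bounded_linear_endo_app] Zf])
  then have lim: "((\<lambda>R. integral {0..R} G + endo_app D f) \<longlongrightarrow> endo_app Z N + N' + endo_app D f) at_top"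
    by (intro tendsto_intros) (simp add: has_halfline_integral_def)
  have eq: "integral {0..R} G + endo_app D f = endo_app (F R) f" if "0 \<le> R" for R
  proof -
    have "integral {0..R} G = endo_app (F R) f - endo_app (F 0) f"
      using that by (intro integral_unique fundamental_theorem_of_calculus deriv)
    then show ?thesis
      by (simp add: F_def)
  qed
  have "\<forall>\<^sub>F R in at_top. integral {0..R} G + endo_app D f = endo_app (F R) f"
    using eventually_ge_at_top[of 0] by eventually_elim (rule eq)
  with lim have "((\<lambda>R. endo_app (F R) f) \<longlongrightarrow> endo_app Z N + N' + endo_app D f) at_top"
    by (rule Lim_transform_eventually)
  from halfline_integrable_limit_zero[OF f[folded F_def] this] show ?thesis
    by (simp add: eq_neg_iff_add_eq_0)
qed

section \<open>Operators on a closed subspace\<close>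

text \<open>Operators on the subspace are total functions whose values off \<open>V\<close> are
  arbitrary. Closedness supplies the projection through which they become elements of
  \<open>endo\<close>.\<close>

locale closed_complex_subspace =
  fixes V :: "'a::{complex_inner, banach, perfect_space} set"
  assumes subspace: "subspace V"
    and closed: "closed V"
    and scaleC_mem: "f \<in> V \<Longrightarrow> c *\<^sub>C f \<in> V"
begin

lemmas mem_intros = subspace_0[OF subspace] subspace_add[OF subspace] subspace_diff[OF subspace]
  subspace_neg[OF subspace] subspace_scale[OF subspace] scaleC_mem

definition retraction_op :: "'a \<Rightarrow> 'a" where
  "retraction_op = (SOME R. bounded_linear R \<and> (\<forall>f. R f \<in> V) \<and> (\<forall>f\<in>V. R f = f))"

lemma retraction_op:
  "bounded_linear retraction_op" "retraction_op f \<in> V" "f \<in> V \<Longrightarrow> retraction_op f = f"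
proof -
  obtain R where "bounded_linear R" "\<And>f. R f \<in> V" "\<And>f. f \<in> V \<Longrightarrow> R f = f"
    using bounded_linear_projection[OF subspace closed] by blast
  then have "\<exists>R. bounded_linear R \<and> (\<forall>f. R f \<in> V) \<and> (\<forall>f\<in>V. R f = f)"
    by blast
  from someI_ex[OF this, folded retraction_op_def]
  show "bounded_linear retraction_op" "retraction_op f \<in> V" "f \<in> V \<Longrightarrow> retraction_op f = f"
    by blast+
qed

section \<open>Algebra of bounded operators on the subspace\<close>

lemma bounded_opD:
  assumes "bounded_op V W X"
  shows bounded_op_mem: "f \<in> V \<Longrightarrow> X f \<in> W"
    and bounded_op_add: "f \<in> V \<Longrightarrow> g \<in> V \<Longrightarrow> X (f + g) = X f + X g"
    and bounded_op_scaleC: "f \<in> V \<Longrightarrow> X (c *\<^sub>C f) = c *\<^sub>C X f"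
    and bounded_op_scaleR: "f \<in> V \<Longrightarrow> X (r *\<^sub>R f) = r *\<^sub>R X f"
    and bounded_op_minus: "f \<in> V \<Longrightarrow> X (- f) = - X f"
    and bounded_op_diff: "f \<in> V \<Longrightarrow> g \<in> V \<Longrightarrow> X (f - g) = X f - X g"
proof -
  show mem: "X f \<in> W" if "f \<in> V" for f
    using assms that by (simp add: bounded_op_def)
  show add: "X (f + g) = X f + X g" if "f \<in> V" "g \<in> V" for f g
    using assms that by (simp add: bounded_op_def)
  show scaleC: "X (c *\<^sub>C f) = c *\<^sub>C X f" if "f \<in> V" for c f
    using assms that by (simp add: bounded_op_def)
  show scaleR: "X (r *\<^sub>R f) = r *\<^sub>R X f" if "f \<in> V" for r f
    using scaleC[OF that, of "of_real r"] by (simp only: scaleC_of_real)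
  show minus: "X (- f) = - X f" if "f \<in> V" for f
    using scaleR[OF that, of "-1"] by simp
  show "X (f - g) = X f - X g" if "f \<in> V" "g \<in> V" for f g
    using add[of f "- g"] minus[of g] that mem_intros(4)[of g] by simp
qed

lemma bounded_op_bound:
  assumes "bounded_op V W X"
  obtains K where "0 \<le> K" "\<And>f. f \<in> V \<Longrightarrow> norm (X f) \<le> K * norm f"
proof -
  obtain K where "\<forall>f\<in>V. norm (X f) \<le> K * norm f"
    using assms by (auto simp: bounded_op_def)
  \<comment> \<open>The bound in \<open>bounded_op\<close> has no prescribed sign; a nonnegative one
    is wanted when bounds are multiplied.\<close>
  moreover have "K * norm f \<le> max 0 K * norm f" for f :: 'a
    by (intro mult_right_mono) auto
  ultimately have "norm (X f) \<le> max 0 K * norm f" if "f \<in> V" for f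
    using that by (meson order_trans)
  then show thesis
    by (rule that[of "max 0 K", rotated]) auto
qed

lemma bounded_op_comp:
  assumes X: "bounded_op V V X" and Y: "bounded_op V W Y"
  shows "bounded_op V W (\<lambda>f. Y (X f))"
proof -
  obtain K K' where "0 \<le> K" and K: "\<And>f. f \<in> V \<Longrightarrow> norm (X f) \<le> K * norm f"
    and "0 \<le> K'" and K': "\<And>f. f \<in> V \<Longrightarrow> norm (Y f) \<le> K' * norm f"
    using bounded_op_bound[OF X] bounded_op_bound[OF Y] by metis
  have "norm (Y (X f)) \<le> (K' * K) * norm f" if "f \<in> V" for f
    using K'[OF bounded_op_mem[OF X that]] mult_left_mono[OF K[OF that] \<open>0 \<le> K'\<close>]
    by (simp add: mult.assoc)
  then show ?thesis
    using bounded_opD[OF X] bounded_opD[OF Y] unfolding bounded_op_def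
    by (intro conjI ballI allI exI[of _ "K' * K"]) simp_all
qed

lemma bounded_op_add_op:
  assumes X: "bounded_op V V X" and Y: "bounded_op V V Y"
  shows "bounded_op V V (\<lambda>f. X f + Y f)"
proof -
  obtain K K' where K: "\<And>f. f \<in> V \<Longrightarrow> norm (X f) \<le> K * norm f"
    and K': "\<And>f. f \<in> V \<Longrightarrow> norm (Y f) \<le> K' * norm f"
    using bounded_op_bound[OF X] bounded_op_bound[OF Y] by metis
  have "norm (X f + Y f) \<le> (K + K') * norm f" if "f \<in> V" for f
    using norm_triangle_ineq[of "X f" "Y f"] K[OF that] K'[OF that] by (simp add: distrib_right)
  then show ?thesis
    using bounded_opD[OF X] bounded_opD[OF Y] unfolding bounded_op_def
    by (intro conjI ballI allI exI[of _ "K + K'"]) (simp_all add: mem_intros scaleC_add_right)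
qed

lemma bounded_op_scaleC_op:
  assumes X: "bounded_op V V X"
  shows "bounded_op V V (\<lambda>f. c *\<^sub>C X f)"
proof -
  obtain K where K: "\<And>f. f \<in> V \<Longrightarrow> norm (X f) \<le> K * norm f"
    using bounded_op_bound[OF X] by metis
  have "norm (c *\<^sub>C X f) \<le> (cmod c * K) * norm f" if "f \<in> V" for f
    using mult_left_mono[OF K[OF that], of "cmod c"] by (simp add: norm_scaleC mult.assoc)
  moreover have "c *\<^sub>C d *\<^sub>C f = d *\<^sub>C c *\<^sub>C f" for d and f :: 'a
    by (simp add: scaleC_scaleC mult.commute)
  ultimately show ?thesis
    using bounded_opD[OF X] unfolding bounded_op_def
    by (intro conjI ballI allI exI[of _ "cmod c * K"]) (simp_all add: mem_intros scaleC_add_right)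
qed

lemma bounded_op_scaleR_op: "bounded_op V V X \<Longrightarrow> bounded_op V V (\<lambda>f. r *\<^sub>R X f)"
  using bounded_op_scaleC_op[of X "of_real r"] by (simp only: scaleC_of_real)

lemma bounded_op_minus_op: "bounded_op V V X \<Longrightarrow> bounded_op V V (\<lambda>f. - X f)"
  using bounded_op_scaleR_op[of X "-1"] by simp

lemma bounded_op_diff_op:
  "bounded_op V V X \<Longrightarrow> bounded_op V V Y \<Longrightarrow> bounded_op V V (\<lambda>f. X f - Y f)"
  using bounded_op_add_op[OF _ bounded_op_minus_op, of X Y] by simp

section \<open>Extension of operators to the whole space, and exponentials on the subspace\<close>

lemma bounded_linear_retraction_op:
  assumes X: "bounded_op V W X"
  shows "bounded_linear (\<lambda>f. X (retraction_op f))"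
proof -
  interpret R: bounded_linear retraction_op
    by (rule retraction_op)
  obtain K where K: "0 \<le> K" "\<And>f. f \<in> V \<Longrightarrow> norm (X f) \<le> K * norm f"
    using bounded_op_bound[OF X] by metis
  obtain C where C: "\<And>f. norm (retraction_op f) \<le> norm f * C"
    using R.bounded by metis
  show ?thesis
  proof (rule bounded_linear_intro[where K = "C * K"])
    show "norm (X (retraction_op f)) \<le> norm f * (C * K)" for f
      using K(2)[OF retraction_op(2)[of f]] mult_left_mono[OF C[of f] K(1)] by (simp add: ac_simps)
  qed (simp_all add: R.add R.scaleR bounded_opD[OF X] retraction_op(2))
qed

text \<open>Precomposition with the retraction discards the arbitrary values off \<open>V\<close>;
  for bounded \<open>X\<close> it gives a bounded operator on the whole space that agrees with
  \<open>X\<close> on \<open>V\<close>.\<close>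

definition endo_of :: "('a \<Rightarrow> 'a) \<Rightarrow> 'a endo" where
  "endo_of X = Endo (Blinfun (\<lambda>f. X (retraction_op f)))"

lemma endo_app_endo_of: "bounded_op V V X \<Longrightarrow> endo_app (endo_of X) f = X (retraction_op f)"
  unfolding endo_of_def by (subst endo_app_Endo_Blinfun) (auto dest: bounded_linear_retraction_op)

lemma endo_of_apply: "bounded_op V V X \<Longrightarrow> f \<in> V \<Longrightarrow> endo_app (endo_of X) f = X f"
  by (simp add: endo_app_endo_of retraction_op)

text \<open>The intertwining relation on \<open>V\<close> propagates to powers because
  \<open>Y\<close> leaves \<open>V\<close> invariant, and to the exponentials because
  \<open>C\<close> is continuous.\<close>

lemma endo_app_exp_intertwine:
  assumes C: "bounded_linear C"
    and intertwine: "\<And>f. f \<in> V \<Longrightarrow> endo_app X (C f) = C (endo_app Y f)"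
    and mem: "\<And>f. f \<in> V \<Longrightarrow> endo_app Y f \<in> V"
    and f: "f \<in> V"
  shows "endo_app (exp X) (C f) = C (endo_app (exp Y) f)"
proof -
  interpret C: bounded_linear C
    by (rule C)
  have "endo_app (Y ^ n) f \<in> V \<and> endo_app (X ^ n) (C f) = C (endo_app (Y ^ n) f)" for n
    by (induction n) (simp_all add: f mem intertwine)
  then have "(\<lambda>n. endo_app (X ^ n) (C f) /\<^sub>R fact n) = (\<lambda>n. C (endo_app (Y ^ n) f /\<^sub>R fact n))"
    by (simp add: C.scaleR)
  with endo_app_exp_sums[of X "C f"] have "(\<lambda>n. C (endo_app (Y ^ n) f /\<^sub>R fact n)) sums endo_app (exp X) (C f)"
    by simp
  from sums_unique2[OF this C.sums[OF endo_app_exp_sums]] show ?thesis .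
qed

lemma endo_app_exp_mem:
  assumes "\<And>f. f \<in> V \<Longrightarrow> endo_app Y f \<in> V" "f \<in> V"
  shows "endo_app (exp Y) f \<in> V"
proof -
  have "endo_app (Y ^ n) f \<in> V" for n
    by (induction n) (simp_all add: assms)
  then have mem: "(\<Sum>i<n. endo_app (Y ^ i) f /\<^sub>R fact i) \<in> V" for n
    by (intro subspace_sum subspace_scale subspace)
  have lim: "(\<lambda>n. \<Sum>i<n. endo_app (Y ^ i) f /\<^sub>R fact i) \<longlonglongrightarrow> endo_app (exp Y) f"
    using endo_app_exp_sums[of Y f] by (simp add: sums_def)
  show ?thesis
    by (rule closed_sequentially[OF closed mem lim])
qed

text \<open>Links the pointwise series \<open>exp_op\<close> with the exponential of the Banach
  algebra; on the invariant subspace the two series agree term by term.\<close>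

lemma exp_op_eq:
  assumes "\<And>f. f \<in> V \<Longrightarrow> endo_app Y f = X f" "\<And>f. f \<in> V \<Longrightarrow> X f \<in> V" "f \<in> V"
  shows "exp_op X f = endo_app (exp Y) f"
proof -
  have "(X ^^ n) f \<in> V \<and> endo_app (Y ^ n) f = (X ^^ n) f" for n
    by (induction n) (simp_all add: assms)
  then show ?thesis
    using sums_unique[OF endo_app_exp_sums[of Y f]] by (simp add: exp_op_def)
qed

section \<open>Adjoints and unitary operators on the subspace\<close>

lemma adj_op_eqI:
  assumes "h \<in> V" "\<And>f. f \<in> V \<Longrightarrow> cinner (X f) y = cinner f h"
  shows "adj_op V X y = h"
  unfolding adj_op_def
proof (rule the_equality)
  fix h'
  assume h': "h' \<in> V \<and> (\<forall>f\<in>V. cinner (X f) y = cinner f h')"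
  \<comment> \<open>The difference of two representing vectors lies in \<open>V\<close> and is
    therefore orthogonal to itself.\<close>
  then have "h' - h \<in> V"
    using assms(1) by (intro mem_intros) auto
  then have "cinner (h' - h) h' = cinner (h' - h) h"
    using assms(2) h' by metis
  then have "inner (h' - h) (h' - h) = 0"
    by (metis Re_cinner inner_diff_right right_minus_eq)
  then show "h' = h"
    by simp
qed (use assms in auto)

lemma adj_op:
  assumes X: "bounded_op V V X"
  shows adj_op_mem: "adj_op V X y \<in> V"
    and cinner_adj_op: "f \<in> V \<Longrightarrow> cinner (X f) y = cinner f (adj_op V X y)"
proof -
  obtain K where K: "\<And>f. f \<in> V \<Longrightarrow> norm (X f) \<le> K * norm f"
    using bounded_op_bound[OF X] by metis
  have "\<exists>h\<in>V. \<forall>f\<in>V. inner (X f) y = inner f h"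
  proof (rule Riesz_representation_closed_subspace[OF subspace closed, where K = "K * norm y"])
    show "\<bar>inner (X f) y\<bar> \<le> K * norm y * norm f" if "f \<in> V" for f
      using Cauchy_Schwarz_ineq2[of "X f" y] mult_right_mono[OF K[OF that], of "norm y"]
      by (simp add: ac_simps)
  qed (simp_all add: bounded_opD[OF X] inner_add_left)
  then obtain h where h: "h \<in> V" "\<And>f. f \<in> V \<Longrightarrow> inner (X f) y = inner f h"
    by blast
  \<comment> \<open>The real identity at \<open>f\<close> gives the real part, and at
    \<open>(- \<i>) *\<^sub>C f\<close> the imaginary part.\<close>
  have *: "cinner (X f) y = cinner f h" if "f \<in> V" for f
    using h(2)[OF that] h(2)[OF scaleC_mem[OF that]] that
    by (simp add: cinner_eq_inner bounded_op_scaleC[OF X, symmetric])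
  from adj_op_eqI[OF h(1) *] h(1) * show "adj_op V X y \<in> V"
    "f \<in> V \<Longrightarrow> cinner (X f) y = cinner f (adj_op V X y)"
    by simp_all
qed

text \<open>Preservation of the inner product makes the adjoint a left inverse, and surjectivity
  makes it a right inverse. Its linearity follows from injectivity of \<open>U\<close>, its
  boundedness from isometry.\<close>

lemma unitary_op_adj:
  assumes U: "unitary_op V U"
  shows "bounded_op V V (adj_op V U)"
    and "f \<in> V \<Longrightarrow> adj_op V U (U f) = f"
    and "f \<in> V \<Longrightarrow> U (adj_op V U f) = f"
proof -
  have bU: "bounded_op V V U" and surj: "U ` V = V"
    and iso: "\<And>f g. f \<in> V \<Longrightarrow> g \<in> V \<Longrightarrow> cinner (U f) (U g) = cinner f g"
    using U by (auto simp: unitary_op_def)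
  show left: "adj_op V U (U f) = f" if "f \<in> V" for f
    using that iso by (intro adj_op_eqI) auto
  show right: "U (adj_op V U f) = f" if "f \<in> V" for f
    using that surj left by (metis imageE)
  note mem = adj_op_mem[OF bU]
  have inj: "f = g" if "U f = U g" "f \<in> V" "g \<in> V" for f g
    using that left by metis
  have "norm (adj_op V U f) = norm f" if "f \<in> V" for f
  proof -
    have "cinner (adj_op V U f) (adj_op V U f) = cinner f f"
      using iso[OF mem mem, of f f] right[OF that] by simp
    then have "complex_of_real ((norm (adj_op V U f))\<^sup>2) = complex_of_real ((norm f)\<^sup>2)"
      by (simp only: cinner_self)
    then show ?thesis
      by (simp only: of_real_eq_iff power2_eq_iff_nonneg norm_ge_zero)
  qed
  moreover have "adj_op V U (f + g) = adj_op V U f + adj_op V U g" if "f \<in> V" "g \<in> V" for f g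
    by (rule inj) (simp_all add: mem mem_intros bounded_opD[OF bU] right that)
  moreover have "adj_op V U (c *\<^sub>C f) = c *\<^sub>C adj_op V U f" if "f \<in> V" for c f
    by (rule inj) (simp_all add: mem mem_intros bounded_opD[OF bU] right that)
  ultimately show "bounded_op V V (adj_op V U)"
    unfolding bounded_op_def by (intro conjI ballI allI exI[of _ 1]) (simp_all add: mem)
qed

end

section \<open>The coupling and its wave operators\<close>

text \<open>The abstract core of the argument, resting on the relation between \<open>B\<close> and
  its adjoint and on the strong integral for \<open>M\<close>. The triangular model enters by
  interpretation.\<close>

locale skew_coupling = closed_complex_subspace V
  for V :: "'a::{complex_inner, banach, perfect_space} set" +
  fixes A B U \<rho> M :: "'a \<Rightarrow> 'a" and b :: real
  assumes B: "bounded_op V V B"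
    and A: "A = (\<lambda>f. b *\<^sub>R B (B (B f)))"
    and U: "unitary_op V U"
    and adj_B: "f \<in> V \<Longrightarrow> adj_op V B f = - U (B (adj_op V U f))"
    and \<rho>: "bounded_op V V \<rho>"
    and M: "bounded_op V V M"
    and M_integral: "f \<in> V \<Longrightarrow> has_halfline_integral
         (\<lambda>\<eta>. exp_i (- \<eta>) (adj_op V B)
                (\<rho> ((1 / \<i>) *\<^sub>C (B (exp_i \<eta> B f) - adj_op V B (exp_i \<eta> B f))))) (M f)"
begin

abbreviation U' :: "'a \<Rightarrow> 'a" where
  "U' \<equiv> adj_op V U"

text \<open>\<open>endo\<close> is an algebra over the reals, so the imaginary unit is placed inside
  the generators.\<close>

definition ZA :: "'a endo" where
  "ZA = endo_of (\<lambda>f. \<i> *\<^sub>C A f)"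

definition ZB :: "'a endo" where
  "ZB = endo_of (\<lambda>f. \<i> *\<^sub>C B f)"

text \<open>The counterpart of \<open>T\<close> in the Banach algebra; on \<open>V\<close> the two
  agree by \<open>T_apply\<close>.\<close>

definition E :: "real \<Rightarrow> real \<Rightarrow> 'a endo" where
  "E x t = exp (t *\<^sub>R ZA + x *\<^sub>R ZB)"

definition D :: "'a \<Rightarrow> 'a" where
  "D f = U' (\<rho> ((1 / \<i>) *\<^sub>C (B f - adj_op V B f)))"

definition T :: "real \<Rightarrow> real \<Rightarrow> 'a \<Rightarrow> 'a" where
  "T x t = exp_op (\<lambda>f. \<i> *\<^sub>C (t *\<^sub>R A f + x *\<^sub>R B f))"

lemma U_bounded: "bounded_op V V U"
  using U by (simp add: unitary_op_def)

lemmas U'_bounded = unitary_op_adj(1)[OF U]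
lemmas U'_U = unitary_op_adj(2)[OF U]
lemmas U_U' = unitary_op_adj(3)[OF U]

lemma A_bounded: "bounded_op V V A"
  unfolding A by (intro bounded_op_scaleR_op bounded_op_comp[OF _ B] B)

lemma adj_B_bounded: "bounded_op V V (adj_op V B)"
proof -
  have "bounded_op V V (\<lambda>f. - U (B (U' f)))"
    by (intro bounded_op_minus_op bounded_op_comp[OF _ U_bounded] bounded_op_comp[OF U'_bounded B])
  then show ?thesis
    by (simp add: bounded_op_def adj_B mem_intros)
qed

lemma D_bounded: "bounded_op V V D"
  unfolding D_def
  by (intro bounded_op_comp[OF _ U'_bounded] bounded_op_comp[OF _ \<rho>] bounded_op_scaleC_op
      bounded_op_diff_op B adj_B_bounded)

lemmas mem = mem_intros bounded_op_mem[OF A_bounded] bounded_op_mem[OF B] bounded_op_mem[OF U_bounded]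
  bounded_op_mem[OF U'_bounded] bounded_op_mem[OF \<rho>] bounded_op_mem[OF M] bounded_op_mem[OF D_bounded]
  bounded_op_mem[OF adj_B_bounded]

section \<open>The commuting generators and their two-parameter group\<close>

lemma ZA_apply [simp]: "f \<in> V \<Longrightarrow> endo_app ZA f = \<i> *\<^sub>C A f"
  unfolding ZA_def by (intro endo_of_apply bounded_op_scaleC_op A_bounded)

lemma ZB_apply [simp]: "f \<in> V \<Longrightarrow> endo_app ZB f = \<i> *\<^sub>C B f"
  unfolding ZB_def by (intro endo_of_apply bounded_op_scaleC_op B)

lemma AB_commute: "f \<in> V \<Longrightarrow> A (B f) = B (A f)"
  by (simp add: A bounded_opD[OF B] mem)

text \<open>The retraction lands in \<open>V\<close>, where \<open>A\<close> and \<open>B\<close>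
  commute, so the extended generators commute everywhere.\<close>

lemma ZA_ZB_commute: "ZA * ZB = ZB * ZA"
proof (rule endo_eqI)
  fix f
  have "endo_app ZA f = \<i> *\<^sub>C A (retraction_op f)" "endo_app ZB f = \<i> *\<^sub>C B (retraction_op f)"
    unfolding ZA_def ZB_def by (intro endo_app_endo_of bounded_op_scaleC_op A_bounded B)+
  then show "endo_app (ZA * ZB) f = endo_app (ZB * ZA) f"
    by (simp add: mem retraction_op(2) bounded_op_scaleC[OF A_bounded] bounded_op_scaleC[OF B] AB_commute)
qed

lemma exponent_mem: "f \<in> V \<Longrightarrow> endo_app (t *\<^sub>R ZA + x *\<^sub>R ZB) f \<in> V"
  by (simp add: mem)

lemma E_mem: "f \<in> V \<Longrightarrow> endo_app (E x t) f \<in> V"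
  unfolding E_def by (rule endo_app_exp_mem[OF exponent_mem])

lemma E_add: "E x t * E x' t' = E (x + x') (t + t')"
proof -
  have "E x t * E x' t' = exp ((t *\<^sub>R ZA + x *\<^sub>R ZB) + (t' *\<^sub>R ZA + x' *\<^sub>R ZB))"
    unfolding E_def
    by (rule exp_add_commuting[symmetric]) (simp add: algebra_simps ZA_ZB_commute)
  then show ?thesis
    by (simp add: E_def algebra_simps)
qed

lemma E_add_apply: "endo_app (E x t) (endo_app (E x' t') f) = endo_app (E (x + x') (t + t')) f"
  by (simp flip: endo_app_simps add: E_add)

lemma E_zero: "E 0 0 = 1"
  by (simp add: E_def)

lemma E_ZB:
  assumes f: "f \<in> V"
  shows "endo_app (E x t) (\<i> *\<^sub>C B f) = \<i> *\<^sub>C B (endo_app (E x t) f)"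
proof -
  have comm: "(t *\<^sub>R ZA + x *\<^sub>R ZB) * ZB = ZB * (t *\<^sub>R ZA + x *\<^sub>R ZB)"
    by (simp add: ZA_ZB_commute algebra_simps)
  have "endo_app (E x t) (endo_app ZB f) = endo_app ZB (endo_app (E x t) f)"
    unfolding E_def
    by (rule endo_app_exp_intertwine[OF bounded_linear_endo_app _ exponent_mem f])
      (simp only: comm flip: endo_app_simps(2))
  then show ?thesis
    using f by (simp add: E_mem)
qed

lemma T_apply: "f \<in> V \<Longrightarrow> T x t f = endo_app (E x t) f"
  unfolding T_def E_def
  by (rule exp_op_eq) (simp_all add: mem scaleC_add_right scaleC_scaleR_commute)

lemma exp_i_B: "f \<in> V \<Longrightarrow> exp_i s B f = endo_app (E s 0) f"
  unfolding exp_i_def E_def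
  by (rule exp_op_eq) (simp_all add: mem scaleC_mult_of_real)

section \<open>Symmetry with respect to the form twisted by the unitary operator, and adjoints of
  the group\<close>

lemma B_symmetric:
  assumes "f \<in> V" "z \<in> V"
  shows "cinner (B f) (U z) = - cinner f (U (B z))"
proof -
  interpret r: bounded_linear "cinner f"
    by (rule bounded_linear_cinner_right)
  show ?thesis
    using assms by (simp add: cinner_adj_op[OF B] adj_B mem U'_U r.neg)
qed

text \<open>\<open>A\<close> is a real multiple of an odd power of \<open>B\<close>, and three sign
  changes leave one minus sign.\<close>

lemma A_symmetric:
  assumes "f \<in> V" "z \<in> V"
  shows "cinner (A f) (U z) = - cinner f (U (A z))"
proof -
  interpret l: bounded_linear "\<lambda>h. cinner h (U z)"
    by (rule bounded_linear_cinner_left)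
  interpret r: bounded_linear "cinner f"
    by (rule bounded_linear_cinner_right)
  show ?thesis
    using assms by (simp add: A l.scaleR r.scaleR bounded_opD[OF U_bounded] mem B_symmetric)
qed

text \<open>\<open>cinner\<close> is conjugate linear in its second argument, so moving
  \<open>\<i>\<close> across changes its sign and cancels the minus sign of
  \<open>A_symmetric\<close> and \<open>B_symmetric\<close>.\<close>

lemma exponent_symmetric:
  assumes f: "f \<in> V" and z: "z \<in> V"
  shows "cinner (endo_app (t *\<^sub>R ZA + x *\<^sub>R ZB) f) (U z) = cinner f (U (endo_app (t *\<^sub>R ZA + x *\<^sub>R ZB) z))"
proof -
  interpret l: bounded_linear "\<lambda>h. cinner h (U z)"
    by (rule bounded_linear_cinner_left)
  interpret r: bounded_linear "cinner f"
    by (rule bounded_linear_cinner_right)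
  show ?thesis
    using f z by (simp add: l.add l.scaleR r.add r.scaleR r.neg bounded_opD[OF U_bounded] mem
        cinner_scaleC_left cinner_scaleC_right B_symmetric A_symmetric)
qed

text \<open>Symmetry of the exponent passes to its powers by induction and to the exponential by
  continuity.\<close>

lemma E_symmetric:
  assumes f: "f \<in> V" and z: "z \<in> V"
  shows "cinner (endo_app (E x t) f) (U z) = cinner f (U (endo_app (E x t) z))"
proof -
  define Y where "Y = t *\<^sub>R ZA + x *\<^sub>R ZB"
  have Y_mem: "endo_app (Y ^ n) g \<in> V" if "g \<in> V" for n g
    by (induction n) (simp_all only: power_0 power_Suc endo_app_simps that Y_def exponent_mem[unfolded endo_app_simps])
  have pow: "cinner (endo_app (Y ^ n) f) (U z) = cinner f (U (endo_app (Y ^ n) z))" for n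
    using z
  proof (induction n arbitrary: z)
    case (Suc n)
    have "cinner (endo_app (Y ^ Suc n) f) (U z) = cinner (endo_app (Y ^ n) f) (U (endo_app Y z))"
      using exponent_symmetric[OF Y_mem[OF f] Suc.prems, of t x n] by (simp add: Y_def)
    also have "\<dots> = cinner f (U (endo_app (Y ^ n) (endo_app Y z)))"
      using Suc.prems Y_mem[of z 1] by (intro Suc.IH) simp
    also have "endo_app (Y ^ n) (endo_app Y z) = endo_app (Y ^ Suc n) z"
      by (simp add: power_Suc2 del: power_Suc)
    finally show ?case .
  qed simp
  \<comment> \<open>\<open>U\<close> is known to be linear only on \<open>V\<close>; its extension
    \<open>u\<close> makes the functional on the right bounded linear on the whole space, so the
    series can be taken through it.\<close>
  define u where "u = endo_of U"
  have u: "endo_app u g = U g" if "g \<in> V" for g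
    unfolding u_def by (rule endo_of_apply[OF U_bounded that])
  interpret l: bounded_linear "\<lambda>h. cinner h (U z)"
    by (rule bounded_linear_cinner_left)
  interpret r: bounded_linear "\<lambda>h. cinner f (endo_app u h)"
    by (rule bounded_linear_compose[OF bounded_linear_cinner_right bounded_linear_endo_app])
  have "(\<lambda>n. cinner (endo_app (Y ^ n) f /\<^sub>R fact n) (U z)) sums cinner (endo_app (exp Y) f) (U z)"
    by (rule l.sums[OF endo_app_exp_sums])
  moreover have "(\<lambda>n. cinner f (endo_app u (endo_app (Y ^ n) z /\<^sub>R fact n))) sums cinner f (endo_app u (endo_app (exp Y) z))"
    by (rule r.sums[OF endo_app_exp_sums])
  moreover have "cinner (endo_app (Y ^ n) f /\<^sub>R fact n) (U z)
      = cinner f (endo_app u (endo_app (Y ^ n) z /\<^sub>R fact n))" for n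
    by (simp add: l.scaleR r.scaleR pow u Y_mem z)
  ultimately show ?thesis
    using E_mem[OF z, of x t] by (simp add: sums_unique2 u E_def Y_def)
qed

lemma adj_T: "y \<in> V \<Longrightarrow> adj_op V (T x t) y = U (endo_app (E x t) (U' y))"
  using E_symmetric[of _ "U' y" x t] by (intro adj_op_eqI) (simp_all add: mem E_mem T_apply U_U')

text \<open>By \<open>adj_T\<close> the adjoint is the group conjugated by \<open>U\<close>, and the
  group law inverts it by reversing both parameters.\<close>

lemma inv_adj_T:
  assumes "y \<in> V"
  shows "inv_into V (adj_op V (T x t)) y = U (endo_app (E (- x) (- t)) (U' y))"
proof (rule inv_into_f_eq)
  show "inj_on (adj_op V (T x t)) V"
    by (rule inj_on_inverseI[where g = "\<lambda>y. U (endo_app (E (- x) (- t)) (U' y))"])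
      (simp add: adj_T mem E_mem U'_U E_add_apply E_zero U_U')
  show "adj_op V (T x t) (U (endo_app (E (- x) (- t)) (U' y))) = y"
    using assms by (simp add: adj_T mem E_mem U'_U E_add_apply E_zero U_U')
qed (use assms in \<open>simp add: mem E_mem\<close>)

text \<open>The sign of \<open>- \<eta>\<close> cancels the minus sign in \<open>adj_B\<close>, so
  \<open>U\<close> intertwines the two exponents and hence their exponentials.\<close>

lemma exp_i_adj_B:
  assumes "f \<in> V"
  shows "exp_i (- \<eta>) (adj_op V B) f = U (endo_app (E \<eta> 0) (U' f))"
proof -
  define X where "X = (\<lambda>f. (\<i> * of_real (- \<eta>)) *\<^sub>C adj_op V B f)"
  define u where "u = endo_of U"
  have u: "endo_app u g = U g" if "g \<in> V" for g
    unfolding u_def by (rule endo_of_apply[OF U_bounded that])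
  have X: "bounded_op V V X"
    unfolding X_def by (intro bounded_op_scaleC_op adj_B_bounded)
  have "exp_i (- \<eta>) (adj_op V B) f = endo_app (exp (endo_of X)) f"
    unfolding exp_i_def X_def[symmetric] using bounded_op_mem[OF X] assms
    by (intro exp_op_eq endo_of_apply[OF X])
  also have "\<dots> = endo_app (exp (endo_of X)) (endo_app u (U' f))"
    using assms by (simp add: u mem U_U')
  also have "\<dots> = endo_app u (endo_app (E \<eta> 0) (U' f))"
    unfolding E_def
  proof (rule endo_app_exp_intertwine[OF bounded_linear_endo_app _ exponent_mem])
    fix g
    assume g: "g \<in> V"
    have "endo_app (endo_of X) (endo_app u g) = X (U g)"
      using g by (simp add: u endo_of_apply[OF X] mem)
    also have "\<dots> = (- \<eta>) *\<^sub>R \<i> *\<^sub>C adj_op V B (U g)"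
      by (simp only: X_def scaleC_mult_of_real)
    also have "\<dots> = \<eta> *\<^sub>R \<i> *\<^sub>C U (B g)"
      using g by (simp add: adj_B mem U'_U scaleC_minus_right)
    also have "\<dots> = endo_app u (endo_app (0 *\<^sub>R ZA + \<eta> *\<^sub>R ZB) g)"
      using g by (simp add: u mem bounded_opD[OF U_bounded])
    finally show "endo_app (endo_of X) (endo_app u g) = endo_app u (endo_app (0 *\<^sub>R ZA + \<eta> *\<^sub>R ZB) g)" .
  qed (use assms in \<open>simp_all add: mem\<close>)
  finally show ?thesis
    using assms by (simp add: u mem E_mem)
qed

text \<open>The outer \<open>U'\<close> cancels the \<open>U\<close> produced by
  \<open>exp_i_adj_B\<close>. The integrand then has the same exponential on both sides of
  \<open>D\<close>, the shape of \<open>Sylvester_equation_halfline\<close>.\<close>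

lemma U'_M_integral:
  assumes "f \<in> V"
  shows "has_halfline_integral (\<lambda>\<eta>. endo_app (E \<eta> 0) (D (endo_app (E \<eta> 0) f))) (U' (M f))"
proof -
  define w where "w = endo_of U'"
  have w: "endo_app w g = U' g" if "g \<in> V" for g
    unfolding w_def by (rule endo_of_apply[OF U'_bounded that])
  have "endo_app w (exp_i (- \<eta>) (adj_op V B)
          (\<rho> ((1 / \<i>) *\<^sub>C (B (exp_i \<eta> B f) - adj_op V B (exp_i \<eta> B f)))))
      = endo_app (E \<eta> 0) (D (endo_app (E \<eta> 0) f))" for \<eta>
    using assms by (simp add: exp_i_B exp_i_adj_B mem E_mem D_def w U'_U)
  then show ?thesis
    using has_halfline_integral_bounded_linear[OF M_integral[OF assms] bounded_linear_endo_app[of w]] assms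
    by (simp add: w mem)
qed

text \<open>This is the relation B* M - M B = \<rho> (B* - B) multiplied from the left by
  \<open>U'\<close> and by the scalar \<open>- \<i>\<close>; here it is obtained from the
  integral.\<close>

lemma Sylvester_M:
  assumes f: "f \<in> V"
  shows "\<i> *\<^sub>C B (U' (M f)) + U' (M (\<i> *\<^sub>C B f)) = - D f"
proof -
  have int: "has_halfline_integral
      (\<lambda>\<eta>. endo_app (exp (\<eta> *\<^sub>R ZB) * endo_of D * exp (\<eta> *\<^sub>R ZB)) g) (U' (M g))" if "g \<in> V" for g
    using U'_M_integral[OF that] that by (simp add: E_def endo_of_apply[OF D_bounded] E_mem[where t = 0, unfolded E_def, simplified])
  from Sylvester_equation_halfline[OF int[OF f]] int[of "endo_app ZB f"] f show ?thesis
    by (simp add: mem endo_of_apply[OF D_bounded])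
qed

section \<open>The operator function \<open>\<Gamma>\<close>, the vector \<open>h\<close> and its
  mode\<close>

definition \<Gamma> :: "real \<Rightarrow> real \<Rightarrow> 'a \<Rightarrow> 'a" where
  "\<Gamma> x t f = T x t f + U' (inv_into V (adj_op V (T x t)) (M f))"

lemma \<Gamma>_apply: "f \<in> V \<Longrightarrow> \<Gamma> x t f = endo_app (E x t) f + endo_app (E (- x) (- t)) (U' (M f))"
  by (simp add: \<Gamma>_def T_apply inv_adj_T mem E_mem U'_U)

lemma \<Gamma>_vector_derivative:
  assumes f: "f \<in> V"
  shows "vector_derivative (\<lambda>y. \<Gamma> y t f) (at x) =
    \<i> *\<^sub>C B (endo_app (E x t) f) - \<i> *\<^sub>C B (endo_app (E (- x) (- t)) (U' (M f)))"
proof (rule vector_derivative_at)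
  \<comment> \<open>The second exponential is written with direction \<open>- ZB\<close>, so that
    the derivative rule for commuting exponents covers both summands.\<close>
  have "((\<lambda>y. endo_app (E y t) f + endo_app (exp (- (t *\<^sub>R ZA) + y *\<^sub>R - ZB)) (U' (M f))) has_vector_derivative
      endo_app (ZB * E x t) f + endo_app (- ZB * exp (- (t *\<^sub>R ZA) + x *\<^sub>R - ZB)) (U' (M f))) (at x)"
    unfolding E_def
    by (intro has_vector_derivative_add endo_app_exp_scaleR_vector_derivative) (simp_all add: ZA_ZB_commute)
  then show "((\<lambda>y. \<Gamma> y t f) has_vector_derivative
      \<i> *\<^sub>C B (endo_app (E x t) f) - \<i> *\<^sub>C B (endo_app (E (- x) (- t)) (U' (M f)))) (at x)"
    using f E_mem[of "U' (M f)" "- x" "- t"] by (simp add: \<Gamma>_apply E_def E_mem[unfolded E_def] mem)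
qed

text \<open>By definition \<open>\<Gamma> x t\<close> sends \<open>h + \<i> *\<^sub>C B g\<close> to
  the derivative at \<open>g\<close>. Since the group commutes with \<open>B\<close>, the leading
  terms cancel, and the Sylvester equation evaluates the rest.\<close>

lemma soliton_vector:
  assumes inv: "invertible_op V (\<Gamma> x t)" and g: "g \<in> V"
    and h: "h = inv_into V (\<Gamma> x t) (vector_derivative (\<lambda>y. \<Gamma> y t g) (at x)) - \<i> *\<^sub>C B g"
  shows "h \<in> V" and "h = endo_app (E (- 2 * x) (- 2 * t)) (D g - U' (M h))"
proof -
  define d where "d = vector_derivative (\<lambda>y. \<Gamma> y t g) (at x)"
  define s where "s = inv_into V (\<Gamma> x t) d"
  have d: "d = \<i> *\<^sub>C B (endo_app (E x t) g) - \<i> *\<^sub>C B (endo_app (E (- x) (- t)) (U' (M g)))"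
    unfolding d_def by (rule \<Gamma>_vector_derivative[OF g])
  then have "d \<in> V"
    using g by (simp add: mem E_mem)
  \<comment> \<open>\<open>invertible_op\<close> yields surjectivity, so \<open>inv_into\<close>
    returns a true preimage of \<open>d\<close>.\<close>
  with inv have "d \<in> \<Gamma> x t ` V"
    unfolding invertible_op_def bounded_op_def by (metis image_eqI)
  then have s: "s \<in> V" "\<Gamma> x t s = d"
    unfolding s_def by (auto intro: inv_into_into f_inv_into_f)
  show hV: "h \<in> V"
    using s(1) g by (simp add: h mem flip: d_def s_def)
  define Bg where "Bg = \<i> *\<^sub>C B g"
  have Bg: "Bg \<in> V"
    using g by (simp add: Bg_def mem)
  have s_eq: "s = h + Bg"
    by (simp add: h d_def s_def Bg_def)
  interpret E: bounded_linear "endo_app X" for X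
    by (rule bounded_linear_endo_app)
  have "endo_app (E x t) h + endo_app (E (- x) (- t)) (U' (M h))
      + (endo_app (E x t) Bg + endo_app (E (- x) (- t)) (U' (M Bg))) = d"
    using s hV Bg
    by (simp add: s_eq \<Gamma>_apply E.add bounded_opD[OF M] bounded_opD[OF U'_bounded] mem algebra_simps)
  moreover have "endo_app (E x t) Bg = \<i> *\<^sub>C B (endo_app (E x t) g)"
    unfolding Bg_def by (rule E_ZB[OF g])
  moreover have "\<i> *\<^sub>C B (endo_app (E (- x) (- t)) (U' (M g)))
      = endo_app (E (- x) (- t)) (\<i> *\<^sub>C B (U' (M g)))"
    using g by (simp add: E_ZB mem)
  ultimately have "endo_app (E x t) h = endo_app (E (- x) (- t))
      (- (\<i> *\<^sub>C B (U' (M g)) + U' (M Bg)) - U' (M h))"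
    by (simp add: d E.add E.diff E.neg eq_neg_iff_add_eq_0 algebra_simps)
  also have "\<i> *\<^sub>C B (U' (M g)) + U' (M Bg) = - D g"
    unfolding Bg_def by (rule Sylvester_M[OF g])
  \<comment> \<open>Multiplying by the group at the opposite parameters frees \<open>h\<close> on
    the left and doubles the parameters on the right.\<close>
  finally have "endo_app (E (- x) (- t)) (endo_app (E x t) h)
      = endo_app (E (- x) (- t)) (endo_app (E (- x) (- t)) (D g - U' (M h)))"
    by simp
  then show "h = endo_app (E (- 2 * x) (- 2 * t)) (D g - U' (M h))"
    by (simp add: E_add_apply E_zero)
qed

text \<open>\<open>K\<close> stands for the adjoint of the channel operator applied after
  \<open>sigmaB L\<close>. By the colligation condition, \<open>\<Psi>\<close> acts on a value
  \<open>\<Phi> f\<close> as \<open>D\<close>, then the group, then \<open>\<Phi>\<close>; so the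
  formula for \<open>h\<close> turns into one for its mode.\<close>

theorem mode_equation:
  fixes \<Phi> :: "'a \<Rightarrow> 'e::complex_inner" and K :: "'e \<Rightarrow> 'a"
  assumes \<Phi>: "bounded_op V UNIV \<Phi>"
    and colligation: "\<And>f. f \<in> V \<Longrightarrow> (1 / \<i>) *\<^sub>C (B f - adj_op V B f) = K (\<Phi> f)"
    and inv: "invertible_op V (\<Gamma> x t)" and g: "g \<in> V"
    and h: "h = inv_into V (\<Gamma> x t) (vector_derivative (\<lambda>y. \<Gamma> y t g) (at x)) - \<i> *\<^sub>C B g"
    and \<Psi>: "\<And>x t y. \<Psi> x t y = \<Phi> (T x t (U' (\<rho> (K y))))"
  shows "\<exists>I. has_halfline_integral (\<lambda>\<eta>. \<Psi> (- 2 * x + \<xi> + \<eta>) (- 2 * t) (\<Phi> (exp_i \<eta> B h))) I \<and>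
             \<Phi> (exp_i \<xi> B h) = - I + \<Psi> (- 2 * x + \<xi>) (- 2 * t) (\<Phi> (exp_i 0 B g))"
proof -
  note h = soliton_vector[OF inv g h]
  have \<Psi>_E: "\<Psi> y s (\<Phi> f) = \<Phi> (endo_app (E y s) (D f))" if "f \<in> V" for y s f
    using that by (simp add: \<Psi> D_def mem T_apply flip: colligation)
  \<comment> \<open>The retraction makes this map bounded linear on the whole space, so it can enter
    the strong integral of \<open>U' (M h)\<close>.\<close>
  define L where "L f = \<Phi> (retraction_op (endo_app (E (- 2 * x + \<xi>) (- 2 * t)) f))" for f
  have L: "bounded_linear L"
    unfolding L_def by (rule bounded_linear_compose[OF bounded_linear_retraction_op[OF \<Phi>] bounded_linear_endo_app])
  have L_eq: "L f = \<Phi> (endo_app (E (- 2 * x + \<xi>) (- 2 * t)) f)" if "f \<in> V" for f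
    using that by (simp add: L_def retraction_op E_mem)
  interpret L: bounded_linear L
    by (rule L)
  \<comment> \<open>The group law merges the left exponential of the integrand into the first
    parameter of \<open>\<Psi>\<close>; the right one produces the mode at
    \<open>\<eta>\<close>.\<close>
  have "L (endo_app (E \<eta> 0) (D (endo_app (E \<eta> 0) h)))
      = \<Psi> (- 2 * x + \<xi> + \<eta>) (- 2 * t) (\<Phi> (exp_i \<eta> B h))" for \<eta>
    using h(1) by (simp add: exp_i_B \<Psi>_E E_mem L_eq mem E_add_apply)
  with has_halfline_integral_bounded_linear[OF U'_M_integral[OF h(1)] L]
  have "has_halfline_integral (\<lambda>\<eta>. \<Psi> (- 2 * x + \<xi> + \<eta>) (- 2 * t) (\<Phi> (exp_i \<eta> B h))) (L (U' (M h)))"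
    by simp
  moreover have "\<Phi> (exp_i \<xi> B h) = L (D g - U' (M h))"
  proof -
    have "endo_app (E \<xi> 0) h = endo_app (E (- 2 * x + \<xi>) (- 2 * t)) (D g - U' (M h))"
      by (subst h(2)) (simp add: E_add_apply add.commute)
    then show ?thesis
      using h(1) g by (simp add: exp_i_B L_eq mem)
  qed
  moreover have "L (D g) = \<Psi> (- 2 * x + \<xi>) (- 2 * t) (\<Phi> (exp_i 0 B g))"
    using g by (simp add: exp_i_B E_zero \<Psi>_E L_eq mem)
  ultimately show ?thesis
    by (auto simp: L.diff)
qed

end

section \<open>The space L2 of an interval\<close>

lemma square_integrable_indicator:
  assumes "square_integrable f" "S \<in> sets lebesgue"
  shows "square_integrable (\<lambda>w. indicat_real S w *\<^sub>R f w)"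
  unfolding square_integrable_def
proof
  have [measurable]: "f \<in> borel_measurable lebesgue" "S \<in> sets lebesgue"
    using assms by (auto simp: square_integrable_def)
  show "(\<lambda>w. indicat_real S w *\<^sub>R f w) \<in> borel_measurable lebesgue"
    by measurable
  show "integrable lebesgue (\<lambda>w. (norm (indicat_real S w *\<^sub>R f w))\<^sup>2)"
  proof (rule Bochner_Integration.integrable_bound)
    show "integrable lebesgue (\<lambda>w. (norm (f w))\<^sup>2)"
      using assms(1) by (simp add: square_integrable_def)
    show "(\<lambda>w. (norm (indicat_real S w *\<^sub>R f w))\<^sup>2) \<in> borel_measurable lebesgue"
      by measurable
    show "AE w in lebesgue. norm ((norm (indicat_real S w *\<^sub>R f w))\<^sup>2) \<le> norm ((norm (f w))\<^sup>2)"
      by (rule AE_I2) (simp add: indicator_def)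
  qed
qed

lemma inner_abs_l2:
  assumes "square_integrable f" "square_integrable g"
  shows "inner (abs_l2 f) (abs_l2 g) = (LINT w|lebesgue. inner (f w) (g w))"
  using assms by (intro inner_l2.abs_eq) (simp_all add: l2_rel_def)

lemma perfect_space_nonzero:
  fixes u x :: "'a::real_normed_vector"
  assumes "u \<noteq> 0"
  shows "\<not> open {x}"
proof
  assume "open {x}"
  then obtain e where e: "0 < e" "\<And>y. dist y x < e \<Longrightarrow> y = x"
    by (auto simp: open_dist)
  define y where "y = x + (e / (2 * norm u)) *\<^sub>R u"
  have "dist y x = e / 2"
    using assms e(1) by (simp add: y_def dist_norm)
  then have "y = x"
    using e by simp
  then show False
    using assms e(1) by (simp add: y_def)
qed

text \<open>Supplies the sort required by \<open>endo\<close>. One nonzero vector suffices: the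
  indicator of [0,1] times a unit vector.\<close>

instance l2 :: (finite) perfect_space
proof
  fix x :: "'a l2"
  \<comment> \<open>\<open>undefined\<close> names some index of the finite type; every choice gives
    a unit vector.\<close>
  define f :: "real \<Rightarrow> complex ^ 'a" where "f w = indicat_real {0..1} w *\<^sub>R axis undefined 1" for w
  have sq: "(norm (f w))\<^sup>2 = indicat_real {0..1} w" for w
    by (simp add: f_def norm_axis_1 indicator_def)
  have f: "square_integrable f"
    unfolding square_integrable_def sq unfolding f_def
    by (intro conjI borel_measurable_scaleR borel_measurable_indicator borel_measurable_const
        integrable_real_indicator) simp_all
  have "(norm (abs_l2 f))\<^sup>2 = 1"
    unfolding norm_abs_l2[OF f] sq by simp
  then have "abs_l2 f \<noteq> 0"
    by auto
  then show "\<not> open {x}"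
    by (rule perfect_space_nonzero)
qed

section \<open>Representatives of classes, and functions supported in the interval\<close>

lemma rep_l2_eqI: "square_integrable f \<Longrightarrow> F = abs_l2 f \<Longrightarrow> AE w in lebesgue. rep_l2 F w = f w"
  using rep_abs_l2 by blast

lemma rep_l2_add: "AE w in lebesgue. rep_l2 (f + g) w = rep_l2 f w + rep_l2 g w"
  by (rule rep_l2_eqI[OF square_integrable_add])
     (simp_all add: square_integrable_rep l2_rel_def abs_rep_l2 flip: plus_l2.abs_eq)

lemma rep_l2_scaleC: "AE w in lebesgue. rep_l2 (c *\<^sub>C f) w = c *\<^sub>C rep_l2 f w"
  by (rule rep_l2_eqI[OF square_integrable_scaleC])
     (simp_all add: square_integrable_rep l2_rel_def abs_rep_l2 flip: scaleC_l2.abs_eq)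

lemma rep_l2_zero: "AE w in lebesgue. rep_l2 0 w = 0"
  by (rule rep_l2_eqI[OF square_integrable_zero]) (simp add: zero_l2_def)

lemma L2_interval_scaleC:
  assumes "f \<in> L2_interval l"
  shows "c *\<^sub>C f \<in> L2_interval l"
proof -
  have zero: "c *\<^sub>C (0 :: complex ^ 'a) = 0"
    by (simp add: scaleC_vec_eq)
  show ?thesis
    using assms rep_l2_scaleC[of c f] unfolding L2_interval_def mem_Collect_eq
    by eventually_elim (simp add: zero)
qed

lemma L2_interval_add:
  assumes "f \<in> L2_interval l" "g \<in> L2_interval l"
  shows "f + g \<in> L2_interval l"
  using assms rep_l2_add[of f g] unfolding L2_interval_def mem_Collect_eq
  by eventually_elim simp

lemma subspace_L2_interval: "subspace (L2_interval l :: 'a::finite l2 set)"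
proof (rule subspaceI)
  show "(0 :: 'a l2) \<in> L2_interval l"
    unfolding L2_interval_def mem_Collect_eq using rep_l2_zero[where 'a = 'a] by eventually_elim simp
  show "r *\<^sub>R f \<in> L2_interval l" if "f \<in> L2_interval l" for r and f :: "'a l2"
    using L2_interval_scaleC[OF that, of "of_real r"] by (simp only: scaleC_of_real)
qed (rule L2_interval_add)

text \<open>As an orthogonal complement the space is closed.\<close>

lemma L2_interval_orthogonal:
  "L2_interval l = (\<Inter>f. {g. inner g (abs_l2 (\<lambda>w. indicat_real (- {-l..l}) w *\<^sub>R rep_l2 f w)) = 0})"
proof -
  define c where "c f w = indicat_real (- {-l..l}) w *\<^sub>R rep_l2 f w" for f :: "'a l2" and w
  have c: "square_integrable (c f)" for f
    unfolding c_def by (intro square_integrable_indicator square_integrable_rep) auto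
  have inner_c: "inner g (abs_l2 (c f)) = (LINT w|lebesgue. inner (rep_l2 g w) (c f w))" for f g
    using inner_abs_l2[OF square_integrable_rep c] by (simp add: abs_rep_l2)
  have "inner g (abs_l2 (c f)) = 0" if "g \<in> L2_interval l" for f g
  proof -
    have "AE w in lebesgue. inner (rep_l2 g w) (c f w) = 0"
      using that unfolding L2_interval_def mem_Collect_eq
      by eventually_elim (auto simp: c_def indicator_def)
    then show ?thesis
      unfolding inner_c by (rule integral_eq_zero_AE)
  qed
  \<comment> \<open>Testing \<open>g\<close> against its own part outside the interval gives the
    integral of its squared norm there.\<close>
  moreover have "g \<in> L2_interval l" if "inner g (abs_l2 (c g)) = 0" for g
  proof -
    have "(LINT w|lebesgue. inner (rep_l2 g w) (c g w)) = 0"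
      using that by (simp add: inner_c)
    moreover have "integrable lebesgue (\<lambda>w. inner (rep_l2 g w) (c g w))"
      by (rule integrable_inner_l2[OF square_integrable_rep c])
    ultimately have "AE w in lebesgue. inner (rep_l2 g w) (c g w) = 0"
      by (subst (asm) integral_nonneg_eq_0_iff_AE) (auto simp: c_def)
    then show ?thesis
      unfolding L2_interval_def mem_Collect_eq by eventually_elim (auto simp: c_def indicator_def split: if_splits)
  qed
  ultimately show ?thesis
    unfolding c_def by blast
qed

lemma closed_L2_interval: "closed (L2_interval l)"
  unfolding L2_interval_orthogonal by (intro closed_INT ballI closed_Collect_eq continuous_intros)

theorem theorem3p3:
  fixes l b x t \<xi> :: real
    and r :: nat
    and P :: "real \<Rightarrow> complex ^ 'm::{finite, linorder} ^ 'p::finite"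
    and L S0 :: "complex ^ 'm::{finite, linorder} ^ 'm::{finite, linorder}"
    and H :: "'p l2 set"
    and A B U \<rho> \<rho>t M :: "'p l2 \<Rightarrow> 'p l2"
    and \<Phi>t :: "'p l2 \<Rightarrow> complex ^ 'm::{finite, linorder} ^ 3"
    and \<gamma>t :: "complex ^ 'm::{finite, linorder} ^ 3 \<Rightarrow> complex ^ 'm::{finite, linorder} ^ 3"
    and T \<Gamma> \<Gamma>x S :: "real \<Rightarrow> real \<Rightarrow> 'p l2 \<Rightarrow> 'p l2"
    and \<Psi> :: "real \<Rightarrow> real \<Rightarrow> complex ^ 'm::{finite, linorder} ^ 3 \<Rightarrow> complex ^ 'm::{finite, linorder} ^ 3"
    and v :: "'p l2 \<Rightarrow> real \<Rightarrow> complex ^ 'm::{finite, linorder} ^ 3"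
    and g h :: "'p l2"
  assumes data: "triangular_data l r P L S0"
    and H: "H = L2_interval l"
    and B: "B = model_op l P L S0"
    and U: "unitary_op H U" "\<forall>f\<in>H. adj_op H B f = - U (B (adj_op H U f))"
    and A: "A = (\<lambda>f. b *\<^sub>R B (B (B f)))"
    and \<Phi>t: "\<Phi>t = channel3 l P (adj_op H B)"
    and \<gamma>t: "\<gamma>t = (\<lambda>y. gamma_in b L y +
        \<i> *\<^sub>C (sigmaA b L (\<Phi>t (adj_op H \<Phi>t (sigmaB L y)))
             - sigmaB L (\<Phi>t (adj_op H \<Phi>t (sigmaA b L y)))))"
    and X: "commutative_regular_colligation A B H \<Phi>t (sigmaA b L) (sigmaB L) (gamma_in b L) \<gamma>t"
    and \<rho>: "bounded_op H H \<rho>" "\<forall>f\<in>H. \<rho> (mult_op l f) = mult_op l (\<rho> f)"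
    and M: "bounded_op H H M"
      "\<forall>f\<in>H. has_halfline_integral
         (\<lambda>\<eta>. exp_i (- \<eta>) (adj_op H B)
                (\<rho> ((1 / \<i>) *\<^sub>C (B (exp_i \<eta> B f) - adj_op H B (exp_i \<eta> B f))))) (M f)"
    and T: "T = (\<lambda>x t. exp_op (\<lambda>f. \<i> *\<^sub>C (t *\<^sub>R A f + x *\<^sub>R B f)))"
    and \<Gamma>: "\<Gamma> = (\<lambda>x t f. T x t f + adj_op H U (inv_into H (adj_op H (T x t)) (M f)))"
    and \<Gamma>x: "\<Gamma>x = (\<lambda>x t f. vector_derivative (\<lambda>y. \<Gamma> y t f) (at x))"
    and S: "S = (\<lambda>x t f. inv_into H (\<Gamma> x t) (\<Gamma>x x t f))"
    and \<rho>t: "\<rho>t = (\<lambda>f. adj_op H U (\<rho> f))"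
    and \<Psi>: "\<Psi> = (\<lambda>x t y. \<Phi>t (T x t (\<rho>t (adj_op H \<Phi>t (sigmaB L y)))))"
    and v: "v = (\<lambda>f \<xi>. \<Phi>t (exp_i \<xi> B f))"
    and inv: "invertible_op H (\<Gamma> x t)"
    and g: "g \<in> (\<lambda>f. B f - adj_op H B f) ` H"
    and h: "h = S x t g - \<i> *\<^sub>C B g"
  shows "\<exists>I. has_halfline_integral (\<lambda>\<eta>. \<Psi> (- 2 * x + \<xi> + \<eta>) (- 2 * t) (v h \<eta>)) I \<and>
             v h \<xi> = - I + \<Psi> (- 2 * x + \<xi>) (- 2 * t) (v g 0)"
proof -
  \<comment> \<open>Closedness of \<open>H\<close> comes from its description as an orthogonal
    complement; boundedness of \<open>B\<close> is a clause of the colligation hypothesis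
    \<open>X\<close>.\<close>
  interpret skew_coupling H A B U \<rho> M b
  proof
    show "subspace H" "closed H"
      by (simp_all add: H subspace_L2_interval closed_L2_interval)
    show "c *\<^sub>C f \<in> H" if "f \<in> H" for f c
      using that unfolding H by (rule L2_interval_scaleC)
    show "bounded_op H H B"
      using X by (simp add: commutative_regular_colligation_def)
  qed (fact A U(1) U(2)[rule_format] \<rho>(1) M(1) M(2)[rule_format])+
  have T_eq: "T = skew_coupling.T A B"
    by (simp add: T T_def fun_eq_iff)
  have \<Gamma>_eq: "\<Gamma> = skew_coupling.\<Gamma> H A B U M"
    by (simp add: \<Gamma> T_eq \<Gamma>_def fun_eq_iff)
  have \<Phi>: "bounded_op H UNIV \<Phi>t"
    and colligation: "\<And>f. f \<in> H \<Longrightarrow> (1 / \<i>) *\<^sub>C (B f - adj_op H B f) = adj_op H \<Phi>t (sigmaB L (\<Phi>t f))"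
    using X by (auto simp: commutative_regular_colligation_def)
  have "g \<in> H"
    using g by (auto simp: mem)
  show ?thesis
    unfolding v
    \<comment> \<open>Unification with \<open>colligation\<close> takes the adjoint channel operator
      after \<open>sigmaB L\<close> for \<open>K\<close>.\<close>
    by (rule mode_equation[OF \<Phi> colligation inv[unfolded \<Gamma>_eq] \<open>g \<in> H\<close>])
       (simp_all add: h S \<Gamma>x \<Gamma>_eq \<Psi> T_eq \<rho>t)
qed

end
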